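(* Let $\omega_S=\frac{i}{2\pi}\partial\bar\partial\left(|z|^2+\log|z|^2\right)$ be the Simanca Kähler form on $\mathbb{C}^2\setminus\{0\}$, where $|z|^2=|z_1|^2+|z_2|^2$. Then $(\mathbb{C}^2\setminus\{0\},\omega_S)$ admits a Berezin quantization.
   Context: **Simanca form.** $\omega_S$ above is the restriction, to the dense subset $\tilde{\mathbb{C}}^2\setminus H\cong\mathbb{C}^2\setminus\{0\}$ (with $H$ the exceptional divisor), of the Kähler form of the Simanca metric on the blow-up $\tilde{\mathbb{C}}^2$ of $\mathbb{C}^2$ at the origin. **Berezin quantization.** Let $(M,\omega)$ be a symplectic manifold with associated Poisson bracket $\{\cdot,\cdot\}$. A Berezin quantization on $M$ is given by a family of associative algebras $\mathcal{A}_\hbar$ (of complex-valued functions on $M$, each with its own associative product), where the parameter $\hbar$ ranges over a set $E$ of positive reals with limit point $0$, such that the following holds. In the direct sum $\bigoplus_{\hbar\in E}\mathcal{A}_\hbar$, understood as the algebra of families $f=(f(\hbar))_{\hbar\in E}$ with $f(\hbar)\in\mathcal{A}_\hbar$ and with component-wise product $*$, there exists a subalgebra $\mathcal{A}$ such that: 1. for every $f=f(\hbar)\in\mathcal{A}$ there exists a limit $\lim_{\hbar\to0}f(\hbar)=\varphi(f)\in C^\infty(M)$; 2. (correspondence principle) for all $f,g\in\mathcal{A}$, $$\varphi(f*g)=\varphi(f)\varphi(g),\qquad \varphi\big(\hbar^{-1}(f*g-g*f)\big)=i\{\varphi(f),\varphi(g)\},$$ where $\varphi(\hbar^{-1}(f*g-g*f))$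 denotes the limit as $\hbar\to0$ of $\hbar^{-1}(f*g-g*f)(\hbar)$; 3. for any pair of distinct points $x_1,x_2\in M$ there exists $f\in\mathcal{A}$ such that $\varphi(f)(x_1)\ne\varphi(f)(x_2)$. *)

theory Defs
  imports "HOL-Analysis.Analysis"
begin

section \<open>Smooth functions on open sets\<close>

text \<open>Only meant for open \<open>S\<close>: the derivative below is the full one at a point, not one within
  \<open>S\<close>. The real notion of differentiability is used, also for complex-valued functions.\<close>

primrec Ck_on :: "nat \<Rightarrow> 'a::real_normed_vector set \<Rightarrow> ('a \<Rightarrow> 'b::real_normed_vector) \<Rightarrow> bool" where
  "Ck_on 0 S f \<longleftrightarrow> continuous_on S f"
| "Ck_on (Suc k) S f \<longleftrightarrow>
     f differentiable_on S \<and> (\<forall>v. Ck_on k S (\<lambda>x. frechet_derivative f (at x) v))"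

definition smooth_on :: "'a::real_normed_vector set \<Rightarrow> ('a \<Rightarrow> 'b::real_normed_vector) \<Rightarrow> bool" where
  "smooth_on S f \<longleftrightarrow> (\<forall>k. Ck_on k S f)"


section \<open>Symplectic forms on open subsets of a Euclidean space\<close>

text \<open>A 2-form is a map \<open>\<omega>\<close> with \<open>\<omega> x u v\<close> its value at the point \<open>x\<close> on the tangent vectors \<open>u\<close>
  and \<open>v\<close>. The last axiom is \<open>d\<omega> = 0\<close>, evaluated on constant (hence commuting) vector fields.\<close>

locale symplectic_domain =
  fixes M :: "'a::euclidean_space set" and \<omega> :: "'a \<Rightarrow> 'a \<Rightarrow> 'a \<Rightarrow> real"
  assumes open_M: "open M"
    and bilinear: "x \<in> M \<Longrightarrow> bilinear (\<omega> x)"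
    and alternating: "x \<in> M \<Longrightarrow> \<omega> x u u = 0"
    and nondegenerate: "x \<in> M \<Longrightarrow> (\<And>v. \<omega> x u v = 0) \<Longrightarrow> u = 0"
    and smooth: "smooth_on M (\<lambda>x. \<omega> x u v)"
    and closed: "x \<in> M \<Longrightarrow>
          frechet_derivative (\<lambda>y. \<omega> y v w) (at x) u
        + frechet_derivative (\<lambda>y. \<omega> y w u) (at x) v
        + frechet_derivative (\<lambda>y. \<omega> y u v) (at x) w = 0"

text \<open>Sign conventions: \<open>\<omega>(X\<^sub>f, \<cdot>) = df\<close> and \<open>{f, g} = \<omega>(X\<^sub>f, X\<^sub>g)\<close>, so that \<open>{q, p} = 1\<close> for
  \<open>\<omega> = dq \<and> dp\<close>. The bracket is extended complex-bilinearly to complex-valued functions.\<close>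

definition hamiltonian_field ::
  "('a \<Rightarrow> 'a \<Rightarrow> 'a \<Rightarrow> real) \<Rightarrow> ('a::euclidean_space \<Rightarrow> real) \<Rightarrow> 'a \<Rightarrow> 'a" where
  "hamiltonian_field \<omega> f x = (THE X. \<forall>v. \<omega> x X v = frechet_derivative f (at x) v)"

definition real_poisson_bracket ::
  "('a \<Rightarrow> 'a \<Rightarrow> 'a \<Rightarrow> real) \<Rightarrow> ('a::euclidean_space \<Rightarrow> real) \<Rightarrow> ('a \<Rightarrow> real) \<Rightarrow> 'a \<Rightarrow> real" where
  "real_poisson_bracket \<omega> f g x = \<omega> x (hamiltonian_field \<omega> f x) (hamiltonian_field \<omega> g x)"

definition poisson_bracket ::
  "('a \<Rightarrow> 'a \<Rightarrow> 'a \<Rightarrow> real) \<Rightarrow> ('a::euclidean_space \<Rightarrow> complex) \<Rightarrow> ('a \<Rightarrow> complex) \<Rightarrow> 'a \<Rightarrow> complex"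
where
  "poisson_bracket \<omega> f g x =
     (let fr = \<lambda>y. Re (f y); fi = \<lambda>y. Im (f y); gr = \<lambda>y. Re (g y); gi = \<lambda>y. Im (g y)
      in Complex (real_poisson_bracket \<omega> fr gr x - real_poisson_bracket \<omega> fi gi x)
                 (real_poisson_bracket \<omega> fr gi x + real_poisson_bracket \<omega> fi gr x))"


section \<open>Berezin quantizations\<close>

text \<open>A function on \<open>M\<close> is encoded as a function on the ambient space that vanishes off \<open>M\<close>, so
  that it is determined by its values on \<open>M\<close>. Addition and scalar multiplication in the
  algebra are pointwise; the product \<open>mul\<close> is an arbitrary associative bilinear one. No unit is
  required.\<close>

locale function_algebra =
  fixes M :: "'a set" and A :: "('a \<Rightarrow> complex) set"
    and mul :: "('a \<Rightarrow> complex) \<Rightarrow> ('a \<Rightarrow> complex) \<Rightarrow> 'a \<Rightarrow> complex"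
  assumes support: "f \<in> A \<Longrightarrow> x \<notin> M \<Longrightarrow> f x = 0"
    and zero_mem: "(\<lambda>x. 0) \<in> A"
    and add_mem: "f \<in> A \<Longrightarrow> g \<in> A \<Longrightarrow> (\<lambda>x. f x + g x) \<in> A"
    and scale_mem: "f \<in> A \<Longrightarrow> (\<lambda>x. c * f x) \<in> A"
    and mul_mem: "f \<in> A \<Longrightarrow> g \<in> A \<Longrightarrow> mul f g \<in> A"
    and mul_assoc: "f \<in> A \<Longrightarrow> g \<in> A \<Longrightarrow> h \<in> A \<Longrightarrow> mul (mul f g) h = mul f (mul g h)"
    and mul_add_left: "f \<in> A \<Longrightarrow> g \<in> A \<Longrightarrow> h \<in> A \<Longrightarrow>
          mul (\<lambda>x. f x + g x) h = (\<lambda>x. mul f h x + mul g h x)"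
    and mul_add_right: "f \<in> A \<Longrightarrow> g \<in> A \<Longrightarrow> h \<in> A \<Longrightarrow>
          mul f (\<lambda>x. g x + h x) = (\<lambda>x. mul f g x + mul f h x)"
    and mul_scale_left: "f \<in> A \<Longrightarrow> g \<in> A \<Longrightarrow> mul (\<lambda>x. c * f x) g = (\<lambda>x. c * mul f g x)"
    and mul_scale_right: "f \<in> A \<Longrightarrow> g \<in> A \<Longrightarrow> mul f (\<lambda>x. c * g x) = (\<lambda>x. c * mul f g x)"

text \<open>Here \<open>h\<close> is the reduced Planck constant. Families \<open>(f h)\<close>, with \<open>h\<close> in \<open>E\<close>, are encoded as functions of a real \<open>h\<close> that are zero off \<open>E\<close>.\<close>

definition families :: "real set \<Rightarrow> (real \<Rightarrow> ('a \<Rightarrow> complex) set) \<Rightarrow> (real \<Rightarrow> 'a \<Rightarrow> complex) set" where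
  "families E A = {f. (\<forall>h\<in>E. f h \<in> A h) \<and> (\<forall>h. h \<notin> E \<longrightarrow> f h = (\<lambda>x. 0))}"

definition family_mul ::
  "real set \<Rightarrow> (real \<Rightarrow> ('a \<Rightarrow> complex) \<Rightarrow> ('a \<Rightarrow> complex) \<Rightarrow> 'a \<Rightarrow> complex) \<Rightarrow>
   (real \<Rightarrow> 'a \<Rightarrow> complex) \<Rightarrow> (real \<Rightarrow> 'a \<Rightarrow> complex) \<Rightarrow> real \<Rightarrow> 'a \<Rightarrow> complex" where
  "family_mul E mul f g = (\<lambda>h. if h \<in> E then mul h (f h) (g h) else (\<lambda>x. 0))"

text \<open>\<open>\<B>\<close> is the subalgebra of the algebra of families, and \<open>\<phi> f\<close> is the limit of \<open>f h\<close> as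
  \<open>h \<rightarrow> 0\<close> in \<open>E\<close>, taken pointwise on \<open>M\<close>; it is unique there since \<open>0\<close> is a limit point of \<open>E\<close>.
  The family \<open>h\<^sup>-\<^sup>1 (f * g - g * f)\<close> need not belong to \<open>\<B>\<close>, so its limit is stated directly.\<close>

locale berezin_quantization = symplectic_domain M \<omega>
  for M :: "'a::euclidean_space set" and \<omega> :: "'a \<Rightarrow> 'a \<Rightarrow> 'a \<Rightarrow> real" +
  fixes E :: "real set"
    and A :: "real \<Rightarrow> ('a \<Rightarrow> complex) set"
    and mul :: "real \<Rightarrow> ('a \<Rightarrow> complex) \<Rightarrow> ('a \<Rightarrow> complex) \<Rightarrow> 'a \<Rightarrow> complex"
    and \<B> :: "(real \<Rightarrow> 'a \<Rightarrow> complex) set"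
    and \<phi> :: "(real \<Rightarrow> 'a \<Rightarrow> complex) \<Rightarrow> 'a \<Rightarrow> complex"
  assumes E_pos: "E \<subseteq> {0<..}"
    and E_limit_point: "0 islimpt E"
    and algebras: "h \<in> E \<Longrightarrow> function_algebra M (A h) (mul h)"
    and \<B>_families: "\<B> \<subseteq> families E A"
    and \<B>_zero: "(\<lambda>h x. 0) \<in> \<B>"
    and \<B>_add: "f \<in> \<B> \<Longrightarrow> g \<in> \<B> \<Longrightarrow> (\<lambda>h x. f h x + g h x) \<in> \<B>"
    and \<B>_scale: "f \<in> \<B> \<Longrightarrow> (\<lambda>h x. c * f h x) \<in> \<B>"
    and \<B>_mul: "f \<in> \<B> \<Longrightarrow> g \<in> \<B> \<Longrightarrow> family_mul E mul f g \<in> \<B>"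
    and limit: "f \<in> \<B> \<Longrightarrow> x \<in> M \<Longrightarrow> ((\<lambda>h. f h x) \<longlongrightarrow> \<phi> f x) (at 0 within E)"
    and limit_smooth: "f \<in> \<B> \<Longrightarrow> smooth_on M (\<phi> f)"
    and limit_product: "f \<in> \<B> \<Longrightarrow> g \<in> \<B> \<Longrightarrow> x \<in> M \<Longrightarrow>
          \<phi> (family_mul E mul f g) x = \<phi> f x * \<phi> g x"
    and limit_commutator: "f \<in> \<B> \<Longrightarrow> g \<in> \<B> \<Longrightarrow> x \<in> M \<Longrightarrow>
          ((\<lambda>h. (family_mul E mul f g h x - family_mul E mul g f h x) / of_real h)
             \<longlongrightarrow> \<i> * poisson_bracket \<omega> (\<phi> f) (\<phi> g) x) (at 0 within E)"
    and separates_points: "x1 \<in> M \<Longrightarrow> x2 \<in> M \<Longrightarrow> x1 \<noteq> x2 \<Longrightarrow> \<exists>f\<in>\<B>. \<phi> f x1 \<noteq> \<phi> f x2"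

definition admits_berezin_quantization ::
  "'a::euclidean_space set \<Rightarrow> ('a \<Rightarrow> 'a \<Rightarrow> 'a \<Rightarrow> real) \<Rightarrow> bool" where
  "admits_berezin_quantization M \<omega> \<longleftrightarrow> (\<exists>E A mul \<B> \<phi>. berezin_quantization M \<omega> E A mul \<B> \<phi>)"


section \<open>The Simanca form\<close>

definition d_dz :: "'n \<Rightarrow> (complex ^ 'n::finite \<Rightarrow> complex) \<Rightarrow> complex ^ 'n \<Rightarrow> complex" where
  "d_dz j f z = (frechet_derivative f (at z) (axis j 1)
                 - \<i> * frechet_derivative f (at z) (axis j \<i>)) / 2"

definition d_dzbar :: "'n \<Rightarrow> (complex ^ 'n::finite \<Rightarrow> complex) \<Rightarrow> complex ^ 'n \<Rightarrow> complex" where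
  "d_dzbar j f z = (frechet_derivative f (at z) (axis j 1)
                    + \<i> * frechet_derivative f (at z) (axis j \<i>)) / 2"

text \<open>The \<open>(1,1)\<close>-form \<open>\<partial> \<partial>bar f\<close>, i.e. the sum over \<open>j, k\<close> of
  \<open>(\<partial>\<^sup>2f / \<partial>z\<^sub>j \<partial>zbar\<^sub>k) dz\<^sub>j \<and> dzbar\<^sub>k\<close>, with the convention \<open>(\<alpha> \<and> \<beta>)(u, v) = \<alpha>(u) \<beta>(v) - \<alpha>(v) \<beta>(u)\<close>.\<close>

definition ddbar ::
  "(complex ^ 'n::finite \<Rightarrow> complex) \<Rightarrow> complex ^ 'n \<Rightarrow> complex ^ 'n \<Rightarrow> complex ^ 'n \<Rightarrow> complex" where
  "ddbar f z u v =
     (\<Sum>j\<in>UNIV. \<Sum>k\<in>UNIV. d_dz j (d_dzbar k f) z * (u $ j * cnj (v $ k) - v $ j * cnj (u $ k)))"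

definition simanca_potential :: "complex ^ 2 \<Rightarrow> real" where
  "simanca_potential z =
     (let r = (cmod (z $ 1))\<^sup>2 + (cmod (z $ 2))\<^sup>2 in r + ln r)"

text \<open>The form \<open>i \<partial> \<partial>bar f\<close> is real for real \<open>f\<close>; taking \<open>Re\<close> only adjusts the type.\<close>

definition simanca_form :: "complex ^ 2 \<Rightarrow> complex ^ 2 \<Rightarrow> complex ^ 2 \<Rightarrow> real" where
  "simanca_form z u v =
     Re (\<i> / (2 * of_real pi) * ddbar (\<lambda>w. of_real (simanca_potential w)) z u v)"

end

theory Submission
  imports Defs
begin

text \<open>The radial map \<open>w(z) = sqrt (1 + 1/|z|\<^sup>2) z\<close> is the reason why the theorem holds. It sends the
  punctured plane injectively onto the outside of the closed unit ball, and the Simanca form is the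
  pullback of a constant form, a multiple of \<open>\<Sum> dw\<^sub>j \<and> dwbar\<^sub>j\<close> (\<open>simanca_form_pullback\<close>): for a
  potential \<open>\<Phi>(|z|\<^sup>2)\<close> this is what scaling by \<open>sqrt (\<Phi>'(|z|\<^sup>2))\<close> does in general, and here
  \<open>\<Phi>'(t) = 1 + 1/t\<close>. So the Simanca form makes the punctured plane an open piece of a flat symplectic
  vector space, and a Weyl quantization of the flat space can be restricted to it.

  In detail, let \<open>W\<close> be an injective smooth map that pulls back a constant form \<open>\<omega>0\<close> to \<open>\<omega>\<close>, and write
  \<open>e\<^sub>\<xi> = exp (\<xi> \<bullet> W)\<close>. The Poisson brackets of the functions \<open>\<xi> \<bullet> W\<close> are constants \<open>\<sigma> \<xi> \<eta>\<close>, hence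
  \<open>{e\<^sub>\<xi>, e\<^sub>\<eta>} = \<sigma> \<xi> \<eta> e\<^sub>\<xi>\<^sub>+\<^sub>\<eta>\<close> (\<open>poisson_bracket_expsum\<close>). The exponentials are linearly independent
  (\<open>exponentials_independent\<close>), so that the rule \<open>e\<^sub>\<xi> * e\<^sub>\<eta> = exp (i h \<sigma> \<xi> \<eta> / 2) e\<^sub>\<xi>\<^sub>+\<^sub>\<eta>\<close> extends bilinearly to
  their span. The product is associative because \<open>\<sigma>\<close> is biadditive (\<open>phase_cocycle\<close>); at \<open>h = 0\<close> it is
  the pointwise one, and its commutator divided by \<open>h\<close> tends to \<open>i\<close> times the bracket
  (\<open>phase_commutator_tendsto\<close>).

  The subalgebra of families consists of the exponential sums over one finite set of frequencies
  whose coefficients converge as \<open>h \<rightarrow> 0\<close>; all limits are then limits of finite sums. Points are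
  separated because \<open>W\<close> is injective. The exponents \<open>\<xi> \<bullet> W\<close> are real so that the real and imaginary parts
  of a sum, from which its bracket is defined, come from those of the coefficients.\<close>

section \<open>Calculus of smooth functions\<close>

lemma Ck_on_Suc_has_derivative:
  assumes "open S" "Ck_on (Suc k) S f" "x \<in> S"
  shows "(f has_derivative frechet_derivative f (at x)) (at x)"
  using assms by (simp add: differentiable_on_eq_differentiable_at frechet_derivative_works)

lemma Ck_on_cong:
  assumes "open S" "Ck_on k S f" "\<And>x. x \<in> S \<Longrightarrow> f x = g x"
  shows "Ck_on k S g"
  using assms(2,3)
proof (induction k arbitrary: f g)
  case 0
  then show ?case using continuous_on_cong[of S S f g] by simp
next
  case (Suc k)
  have g: "(g has_derivative frechet_derivative f (at x)) (at x)" if "x \<in> S" for x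
    using Ck_on_Suc_has_derivative[OF assms(1) Suc.prems(1) that] assms(1) that
    by (rule has_derivative_transform_within_open) (use Suc.prems(2) in auto)
  then have "g differentiable_on S"
    by (meson differentiableI differentiable_at_imp_differentiable_on)
  moreover have "Ck_on k S (\<lambda>x. frechet_derivative g (at x) v)" for v
    by (rule Suc.IH[of "\<lambda>x. frechet_derivative f (at x) v"])
      (use Suc.prems(1) in \<open>simp_all add: frechet_derivative_at[OF g, symmetric]\<close>)
  ultimately show ?case by simp
qed

text \<open>Any formula for the derivative on \<open>S\<close> may replace \<open>frechet_derivative\<close>, whose values outside \<open>S\<close> are
  arbitrary. All closure properties of smooth functions rest on this.\<close>

lemma Ck_onI_derivative:
  assumes "open S" "\<And>x. x \<in> S \<Longrightarrow> (f has_derivative f' x) (at x)"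
    and "\<And>v. Ck_on k S (\<lambda>x. f' x v)"
  shows "Ck_on (Suc k) S f"
proof -
  have "f differentiable_on S"
    using assms(2) by (meson differentiableI differentiable_at_imp_differentiable_on)
  moreover have "Ck_on k S (\<lambda>x. frechet_derivative f (at x) v)" for v
    by (rule Ck_on_cong[OF assms(1) assms(3)[of v]]) (simp add: frechet_derivative_at[OF assms(2), symmetric])
  ultimately show ?thesis by simp
qed

lemma Ck_on_Suc_imp:
  assumes "Ck_on (Suc k) S f"
  shows "Ck_on k S f"
  using assms
proof (induction k arbitrary: f)
  case 0
  then show ?case by (simp add: differentiable_imp_continuous_on)
next
  case (Suc k)
  then show ?case by simp
qed

lemma Ck_on_const: "open S \<Longrightarrow> Ck_on k S (\<lambda>x. c)"
proof (induction k arbitrary: c)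
  case (Suc k)
  then show ?case by (intro Ck_onI_derivative[where f'="\<lambda>_ _. 0"]) auto
qed simp

lemma Ck_on_bounded_linear:
  assumes "open S" "bounded_linear L" "Ck_on k S g"
  shows "Ck_on k S (\<lambda>x. L (g x))"
  using assms(3)
proof (induction k arbitrary: g)
  case 0
  then show ?case using bounded_linear.continuous_on[OF assms(2)] by simp
next
  case (Suc k)
  show ?case
    by (rule Ck_onI_derivative[OF assms(1) bounded_linear.has_derivative[OF assms(2) Ck_on_Suc_has_derivative[OF assms(1) Suc.prems]]])
      (use Suc in auto)
qed

lemma Ck_on_id: "open S \<Longrightarrow> Ck_on k S (\<lambda>x. x)"
proof (cases k)
  case (Suc j)
  assume "open S"
  then show ?thesis unfolding Suc
    by (intro Ck_onI_derivative[where f'="\<lambda>_ v. v"] Ck_on_const) auto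
qed simp

lemma Ck_on_add:
  assumes "open S" "Ck_on k S f" "Ck_on k S g"
  shows "Ck_on k S (\<lambda>x. f x + g x)"
  using assms(2,3)
proof (induction k arbitrary: f g)
  case 0
  then show ?case by (simp add: continuous_on_add)
next
  case (Suc k)
  note D = Suc.prems[THEN Ck_on_Suc_has_derivative[OF assms(1)]]
  show ?case
    by (rule Ck_onI_derivative[OF assms(1) has_derivative_add[OF D]]) (use Suc in auto)
qed

lemma Ck_on_bounded_bilinear:
  assumes "open S" "bounded_bilinear B" "Ck_on k S f" "Ck_on k S g"
  shows "Ck_on k S (\<lambda>x. B (f x) (g x))"
  using assms(3,4)
proof (induction k arbitrary: f g)
  case 0
  then show ?case using bounded_bilinear.continuous_on[OF assms(2)] by simp
next
  case (Suc k)
  note D = Suc.prems[THEN Ck_on_Suc_has_derivative[OF assms(1)]]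
  have "Ck_on k S f" "Ck_on k S g" using Suc.prems Ck_on_Suc_imp by blast+
  with Suc show ?case
    by (intro Ck_onI_derivative[OF assms(1) bounded_bilinear.FDERIV[OF assms(2) D]]
        Ck_on_add[OF assms(1)]) auto
qed

text \<open>The outer function comes with the sequence of all its derivatives, since the chain rule for \<open>G n\<close>
  produces \<open>G (Suc n)\<close>; the induction on \<open>k\<close> therefore has to be for all \<open>n\<close> at once.\<close>

lemma Ck_on_compose_real:
  fixes f :: "'a::real_normed_vector \<Rightarrow> real" and G :: "nat \<Rightarrow> real \<Rightarrow> real"
  assumes "open S" "\<And>n t. t \<in> T \<Longrightarrow> (G n has_real_derivative G (Suc n) t) (at t)"
    and "f ` S \<subseteq> T" "Ck_on k S f"
  shows "Ck_on k S (\<lambda>x. G n (f x))"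
  using assms(4)
proof (induction k arbitrary: n)
  case 0
  have "continuous_on T (G n)"
    using assms(2) by (meson DERIV_isCont continuous_at_imp_continuous_on)
  with 0 assms(3) show ?case by (simp add: continuous_on_compose2)
next
  case (Suc k)
  have "Ck_on k S f" using Suc.prems Ck_on_Suc_imp by blast
  then have IH: "Ck_on k S (\<lambda>x. G (Suc n) (f x))" by (rule Suc.IH)
  show ?case
  proof (rule Ck_onI_derivative[OF assms(1)])
    show "((\<lambda>x. G n (f x)) has_derivative (\<lambda>v. G (Suc n) (f x) * frechet_derivative f (at x) v)) (at x)"
      if "x \<in> S" for x
      using has_derivative_compose[OF Ck_on_Suc_has_derivative[OF assms(1) Suc.prems that],
          of "G n" "(*) (G (Suc n) (f x))"] assms(2)[of "f x" n] assms(3) that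
      by (auto simp: has_field_derivative_def)
    show "Ck_on k S (\<lambda>x. G (Suc n) (f x) * frechet_derivative f (at x) v)" for v
      using Ck_on_bounded_bilinear[OF assms(1) bounded_bilinear_mult IH] Suc.prems by simp
  qed
qed

lemma smooth_on_const: "open S \<Longrightarrow> smooth_on S (\<lambda>x. c)"
  by (simp add: smooth_on_def Ck_on_const)

lemma smooth_on_id: "open S \<Longrightarrow> smooth_on S (\<lambda>x. x)"
  by (simp add: smooth_on_def Ck_on_id)

lemma smooth_on_cong:
  "open S \<Longrightarrow> smooth_on S f \<Longrightarrow> (\<And>x. x \<in> S \<Longrightarrow> f x = g x) \<Longrightarrow> smooth_on S g"
  unfolding smooth_on_def using Ck_on_cong by blast

lemma smooth_on_add:
  "open S \<Longrightarrow> smooth_on S f \<Longrightarrow> smooth_on S g \<Longrightarrow> smooth_on S (\<lambda>x. f x + g x)"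
  by (simp add: smooth_on_def Ck_on_add)

lemma smooth_on_sum:
  assumes "open S" "\<And>i. i \<in> I \<Longrightarrow> smooth_on S (f i)"
  shows "smooth_on S (\<lambda>x. \<Sum>i\<in>I. f i x)"
  using assms(2)
proof (induction I rule: infinite_finite_induct)
  case (insert i I)
  then show ?case by (simp add: smooth_on_add[OF assms(1)])
qed (simp_all add: smooth_on_const[OF assms(1)])

lemma smooth_on_bounded_linear:
  "bounded_linear L \<Longrightarrow> open S \<Longrightarrow> smooth_on S g \<Longrightarrow> smooth_on S (\<lambda>x. L (g x))"
  by (simp add: smooth_on_def Ck_on_bounded_linear)

lemma smooth_on_bounded_bilinear:
  "bounded_bilinear B \<Longrightarrow> open S \<Longrightarrow> smooth_on S f \<Longrightarrow> smooth_on S g \<Longrightarrow> smooth_on S (\<lambda>x. B (f x) (g x))"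
  by (simp add: smooth_on_def Ck_on_bounded_bilinear)

lemma smooth_on_frechet_derivative:
  assumes "smooth_on S f"
  shows "smooth_on S (\<lambda>x. frechet_derivative f (at x) v)"
  using assms unfolding smooth_on_def by (metis Ck_on.simps(2))

lemma smooth_on_has_derivative:
  assumes "open S" "smooth_on S f" "x \<in> S"
  shows "(f has_derivative frechet_derivative f (at x)) (at x)"
  using assms Ck_on_Suc_has_derivative[of S 0 f x] unfolding smooth_on_def by blast

lemma smooth_on_exp:
  fixes f :: "'a::real_normed_vector \<Rightarrow> real"
  assumes "open S" "smooth_on S f"
  shows "smooth_on S (\<lambda>x. exp (f x))"
  unfolding smooth_on_def
proof
  show "Ck_on k S (\<lambda>x. exp (f x))" for k
    by (rule Ck_on_compose_real[of S UNIV "\<lambda>_. exp" f]) (use assms in \<open>auto simp: smooth_on_def\<close>)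
qed

lemma smooth_on_powr:
  fixes f :: "'a::real_normed_vector \<Rightarrow> real"
  assumes "open S" "smooth_on S f" "\<And>x. x \<in> S \<Longrightarrow> f x > 0"
  shows "smooth_on S (\<lambda>x. f x powr a)"
proof -
  \<comment> \<open>the \<open>n\<close>-th derivative of \<open>t powr a\<close>\<close>
  define G where "G n t = (\<Prod>i<n. a - real i) * t powr (a - real n)" for n and t :: real
  have G: "(G n has_real_derivative G (Suc n) t) (at t)" if "t \<in> {0<..}" for n t
  proof -
    have "((\<lambda>t. t powr (a - real n)) has_real_derivative (a - real n) * t powr (a - real n - 1)) (at t)"
      using that by (intro has_real_derivative_powr) auto
    from DERIV_cmult[OF this, of "\<Prod>i<n. a - real i"] show ?thesis
      by (simp add: G_def[abs_def] algebra_simps)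
  qed
  have "Ck_on k S (\<lambda>x. G 0 (f x))" for k
    by (rule Ck_on_compose_real[of S "{0<..}" G f, OF _ G]) (use assms in \<open>auto simp: smooth_on_def\<close>)
  then show ?thesis by (simp add: G_def smooth_on_def)
qed

section \<open>Quantization of a constant symplectic form in a chart\<close>

abbreviation supp :: "('a \<Rightarrow> complex) \<Rightarrow> 'a set" where
  "supp c \<equiv> {\<xi>. c \<xi> \<noteq> 0}"

text \<open>The target of the chart is the vector space in which \<open>M\<close> lies. As the dimensions agree, the
  nondegeneracy of \<open>\<omega>\<close> makes the derivative of \<open>W\<close> bijective at every point.\<close>

locale constant_symplectic_chart = symplectic_domain M \<omega>
  for M :: "'a::euclidean_space set" and \<omega> :: "'a \<Rightarrow> 'a \<Rightarrow> 'a \<Rightarrow> real" +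
  fixes W :: "'a \<Rightarrow> 'a" and \<omega>0 :: "'a \<Rightarrow> 'a \<Rightarrow> real"
  assumes nonempty: "M \<noteq> {}"
    and smooth_W: "smooth_on M W"
    and inj_W: "inj_on W M"
    and bilinear_0: "bilinear \<omega>0"
    and pullback: "x \<in> M \<Longrightarrow> \<omega> x u v = \<omega>0 (frechet_derivative W (at x) u) (frechet_derivative W (at x) v)"
begin

abbreviation DW where "DW x \<equiv> frechet_derivative W (at x)"

lemma W_has_derivative: "x \<in> M \<Longrightarrow> (W has_derivative DW x) (at x)"
  by (rule smooth_on_has_derivative[OF open_M smooth_W])

lemma linear_DW: "x \<in> M \<Longrightarrow> linear (DW x)"
  using W_has_derivative has_derivative_linear by blast

lemma inj_DW:
  assumes "x \<in> M"
  shows "inj (DW x)"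
proof -
  have "u = 0" if "DW x u = 0" for u
    by (rule nondegenerate[OF assms]) (simp add: pullback[OF assms] that bilinear_lzero[OF bilinear_0])
  then show ?thesis
    using linear_injective_0[OF linear_DW[OF assms]] by blast
qed

lemma surj_DW: "x \<in> M \<Longrightarrow> surj (DW x)"
  using linear_injective_imp_surjective linear_DW inj_DW by blast

text \<open>Every vector is of the form \<open>DW x u\<close> at some point \<open>x\<close>; in this way \<open>\<omega>0\<close> inherits the pointwise
  properties of \<open>\<omega>\<close>.\<close>

lemma alternating_0: "\<omega>0 a a = 0"
proof -
  obtain x where x: "x \<in> M" using nonempty by blast
  then obtain u where "DW x u = a" using surj_DW by (metis surjD)
  then show ?thesis using alternating[OF x, of u] pullback[OF x, of u u] by simp
qed

lemma antisym_0: "\<omega>0 b a = - \<omega>0 a b"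
proof -
  have "\<omega>0 a a + \<omega>0 a b + (\<omega>0 b a + \<omega>0 b b) = \<omega>0 (a + b) (a + b)"
    by (simp only: bilinear_ladd[OF bilinear_0] bilinear_radd[OF bilinear_0])
  then show ?thesis by (simp add: alternating_0)
qed

lemma nondegenerate_0:
  assumes "\<And>b. \<omega>0 a b = 0"
  shows "a = 0"
proof -
  obtain x where x: "x \<in> M" using nonempty by blast
  then obtain u where u: "DW x u = a" using surj_DW by (metis surjD)
  have "u = 0"
    by (rule nondegenerate[OF x]) (simp add: pullback[OF x] u assms)
  then show ?thesis using u linear_0[OF linear_DW[OF x]] by simp
qed

lemma linear_0_left: "linear (\<lambda>a. \<omega>0 a b)" and linear_0_right: "linear (\<omega>0 a)"
  using bilinear_0 by (auto simp: bilinear_def)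

text \<open>The matrix \<open>L\<close> of \<open>\<omega>0\<close> is injective by nondegeneracy, and thus surjective.\<close>

lemma ex_dual: "\<exists>p. \<forall>b. \<omega>0 p b = a \<bullet> b"
proof -
  define L where "L a = (\<Sum>b\<in>Basis. \<omega>0 a b *\<^sub>R b)" for a
  have L: "L p \<bullet> b = \<omega>0 p b" for p b
  proof -
    have "\<omega>0 p b = \<omega>0 p (\<Sum>i\<in>Basis. (b \<bullet> i) *\<^sub>R i)" by (simp add: euclidean_representation)
    also have "\<dots> = (\<Sum>i\<in>Basis. (b \<bullet> i) * \<omega>0 p i)"
      by (simp add: linear_sum[OF linear_0_right] linear_cmul[OF linear_0_right])
    finally show ?thesis
      by (simp add: L_def inner_sum_left inner_commute[of b] mult.commute)
  qed
  have "linear L"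
    unfolding L_def by (intro linear_compose_sum ballI linear_scaleR_left linear_compose[OF linear_0_left, unfolded o_def])
  moreover have "inj L"
    unfolding linear_injective_0[OF \<open>linear L\<close>]
    using L nondegenerate_0 by (metis inner_zero_left)
  ultimately have "surj L" by (rule linear_injective_imp_surjective) simp
  then obtain p where "L p = a" by (metis surjD)
  then show ?thesis using L by metis
qed

definition dual :: "'a \<Rightarrow> 'a" where
  "dual a = (SOME p. \<forall>b. \<omega>0 p b = a \<bullet> b)"

lemma dual: "\<omega>0 (dual a) b = a \<bullet> b"
  unfolding dual_def using someI_ex[OF ex_dual] by blast

text \<open>The Poisson tensor: \<open>\<sigma> a b = \<omega>0 (dual a) (dual b)\<close> is the bracket of the linear functions \<open>a \<bullet> w\<close> and
  \<open>b \<bullet> w\<close> on the target of the chart.\<close>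

definition \<sigma> :: "'a \<Rightarrow> 'a \<Rightarrow> real" where
  "\<sigma> a b = a \<bullet> dual b"

lemma \<sigma>_antisym: "\<sigma> b a = - \<sigma> a b"
  unfolding \<sigma>_def by (metis dual antisym_0)

lemma \<sigma>_add_left: "\<sigma> (a + b) c = \<sigma> a c + \<sigma> b c"
  by (simp add: \<sigma>_def inner_add_left)

lemma \<sigma>_add_right: "\<sigma> c (a + b) = \<sigma> c a + \<sigma> c b"
  using \<sigma>_add_left \<sigma>_antisym by (metis minus_add_distrib)

lemma \<sigma>_sum_sum:
  "\<sigma> (\<Sum>i\<in>I. s i *\<^sub>R a i) (\<Sum>j\<in>J. t j *\<^sub>R b j) = (\<Sum>i\<in>I. \<Sum>j\<in>J. s i * t j * \<sigma> (a i) (b j))"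
proof -
  have l: "\<sigma> (\<Sum>i\<in>I. s i *\<^sub>R a i) c = (\<Sum>i\<in>I. s i * \<sigma> (a i) c)" for c and I :: "'b set" and s a
    by (simp add: \<sigma>_def inner_sum_left)
  have r: "\<sigma> c (\<Sum>j\<in>J. t j *\<^sub>R b j) = (\<Sum>j\<in>J. t j * \<sigma> c (b j))" for c
    by (subst (1 2) \<sigma>_antisym) (simp add: \<sigma>_def inner_sum_left sum_negf)
  show ?thesis by (simp only: l) (simp add: r sum_distrib_left mult.assoc)
qed

subsection \<open>Poisson brackets in the chart\<close>

text \<open>The derivative of the chart carries the hamiltonian field of \<open>f\<close> to \<open>dual a\<close>, where \<open>a\<close> is the gradient
  of \<open>f\<close> in the coordinates of the chart.\<close>

lemma real_poisson_bracket_chart: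
  assumes x: "x \<in> M"
    and f: "(f has_derivative (\<lambda>v. a \<bullet> DW x v)) (at x)"
    and g: "(g has_derivative (\<lambda>v. b \<bullet> DW x v)) (at x)"
  shows "real_poisson_bracket \<omega> f g x = \<sigma> a b"
proof -
  have H: "DW x (hamiltonian_field \<omega> f x) = dual a"
    if f: "(f has_derivative (\<lambda>v. a \<bullet> DW x v)) (at x)" for f a
  proof -
    obtain X where X: "DW x X = dual a" using surj_DW[OF x] by (metis surjD)
    have "hamiltonian_field \<omega> f x = X"
      unfolding hamiltonian_field_def frechet_derivative_at[OF f, symmetric]
    proof (rule the_equality)
      show "\<forall>v. \<omega> x X v = a \<bullet> DW x v" by (simp add: pullback[OF x] X dual)
      fix Y assume Y: "\<forall>v. \<omega> x Y v = a \<bullet> DW x v"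
      have "Y - X = 0"
        by (rule nondegenerate[OF x])
          (use Y in \<open>simp add: pullback[OF x] linear_diff[OF linear_DW[OF x]] bilinear_lsub[OF bilinear_0] X dual\<close>)
      then show "Y = X" by simp
    qed
    with X show ?thesis by simp
  qed
  show ?thesis
    by (simp add: real_poisson_bracket_def pullback[OF x] H[OF f] H[OF g] dual \<sigma>_def)
qed

subsection \<open>Exponential sums\<close>

definition expsum :: "('a \<Rightarrow> complex) \<Rightarrow> 'a \<Rightarrow> complex" where
  "expsum c x = (if x \<in> M then \<Sum>\<xi>\<in>supp c. c \<xi> * of_real (exp (\<xi> \<bullet> W x)) else 0)"

lemma expsum_eq:
  assumes "finite F" "supp c \<subseteq> F" "x \<in> M"
  shows "expsum c x = (\<Sum>\<xi>\<in>F. c \<xi> * of_real (exp (\<xi> \<bullet> W x)))"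
  unfolding expsum_def using assms by (auto intro!: sum.mono_neutral_left)

lemma expsum_off: "x \<notin> M \<Longrightarrow> expsum c x = 0"
  by (simp add: expsum_def)

lemma exp_has_derivative:
  assumes "x \<in> M"
  shows "((\<lambda>y. exp (\<xi> \<bullet> W y)) has_derivative (\<lambda>v. exp (\<xi> \<bullet> W x) * (\<xi> \<bullet> DW x v))) (at x)"
  by (auto intro!: derivative_eq_intros W_has_derivative[OF assms])

text \<open>Differentiating a relation \<open>\<Sum> c\<^sub>\<eta> e\<^sub>\<eta> = 0\<close> in a direction \<open>v\<close> with \<open>DW x v = \<delta>\<close>, and subtracting \<open>a \<bullet> \<delta>\<close>
  times the relation, multiplies each coefficient by \<open>(\<eta> - a) \<bullet> \<delta>\<close>. This removes the frequency \<open>a\<close>,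
  and the choice \<open>\<delta> = \<xi> - a\<close> keeps \<open>\<xi>\<close>.\<close>

lemma exponentials_independent:
  assumes "finite F" "\<And>x. x \<in> M \<Longrightarrow> (\<Sum>\<xi>\<in>F. c \<xi> * complex_of_real (exp (\<xi> \<bullet> W x))) = 0" "\<xi> \<in> F"
  shows "c \<xi> = 0"
  using assms
proof (induction F arbitrary: c \<xi> rule: finite_induct)
  case (insert a F)
  have F: "c \<xi> = 0" if "\<xi> \<in> F" for \<xi>
  proof -
    define \<delta> where "\<delta> = \<xi> - a"
    have "(\<Sum>\<eta>\<in>F. (c \<eta> * of_real ((\<eta> - a) \<bullet> \<delta>)) * complex_of_real (exp (\<eta> \<bullet> W x))) = 0"
      if x: "x \<in> M" for x
    proof -
      let ?s = "\<lambda>y. \<Sum>\<eta>\<in>insert a F. c \<eta> * complex_of_real (exp (\<eta> \<bullet> W y))"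
      have "(?s has_derivative (\<lambda>v. \<Sum>\<eta>\<in>insert a F. c \<eta> * of_real (exp (\<eta> \<bullet> W x) * (\<eta> \<bullet> DW x v)))) (at x)"
        by (intro has_derivative_sum has_derivative_mult_right has_derivative_of_real exp_has_derivative[OF x])
      moreover have "(?s has_derivative (\<lambda>v. 0)) (at x)"
        by (rule has_derivative_transform_within_open[OF has_derivative_const open_M x])
          (use insert.prems(1) in simp)
      ultimately have D: "(\<lambda>v. \<Sum>\<eta>\<in>insert a F. c \<eta> * of_real (exp (\<eta> \<bullet> W x) * (\<eta> \<bullet> DW x v))) = (\<lambda>v. 0)"
        by (rule has_derivative_unique)
      obtain v where "DW x v = \<delta>" using surj_DW[OF x] by (metis surjD)
      with fun_cong[OF D, of v] have "(\<Sum>\<eta>\<in>insert a F. c \<eta> * of_real (exp (\<eta> \<bullet> W x) * (\<eta> \<bullet> \<delta>))) = 0" by simp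
      moreover have "of_real (a \<bullet> \<delta>) * ?s x = 0" using insert.prems(1)[OF x] by simp
      ultimately have "(\<Sum>\<eta>\<in>insert a F. c \<eta> * of_real (exp (\<eta> \<bullet> W x) * (\<eta> \<bullet> \<delta>))
          - of_real (a \<bullet> \<delta>) * (c \<eta> * complex_of_real (exp (\<eta> \<bullet> W x)))) = 0"
        by (simp only: sum_subtractf sum_distrib_left) simp
      then show ?thesis
        using insert.hyps by (simp add: inner_diff_left algebra_simps)
    qed
    from insert.IH[OF this \<open>\<xi> \<in> F\<close>] have "c \<xi> * of_real (\<delta> \<bullet> \<delta>) = 0" by (simp add: \<delta>_def)
    moreover have "\<delta> \<noteq> 0" using insert.hyps(2) \<open>\<xi> \<in> F\<close> by (auto simp: \<delta>_def)
    ultimately show ?thesis by simp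
  qed
  obtain x where x: "x \<in> M" using nonempty by blast
  have "c a = 0" using insert.prems(1)[OF x] insert.hyps F by simp
  with F insert.prems(2) show ?case by auto
qed simp

lemma expsum_inj:
  assumes "finite (supp c)" "finite (supp d)" "expsum c = expsum d"
  shows "c = d"
proof
  fix \<xi>
  define F where "F = insert \<xi> (supp c \<union> supp d)"
  have F: "finite F" "supp c \<subseteq> F" "supp d \<subseteq> F" using assms by (auto simp: F_def)
  have "(\<Sum>\<eta>\<in>F. (c \<eta> - d \<eta>) * complex_of_real (exp (\<eta> \<bullet> W x))) = 0" if "x \<in> M" for x
    using fun_cong[OF assms(3), of x] expsum_eq[OF F(1,2) that] expsum_eq[OF F(1,3) that]
    by (simp add: left_diff_distrib sum_subtractf)
  from exponentials_independent[OF F(1) this, of \<xi>] show "c \<xi> = d \<xi>" by (simp add: F_def)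
qed

lemma expsum_has_derivative:
  assumes "finite F" "supp c \<subseteq> F" "x \<in> M"
  shows "(expsum c has_derivative (\<lambda>v. \<Sum>\<xi>\<in>F. c \<xi> * of_real (exp (\<xi> \<bullet> W x) * (\<xi> \<bullet> DW x v)))) (at x)"
proof (rule has_derivative_transform_within_open[OF _ open_M assms(3)])
  show "((\<lambda>y. \<Sum>\<xi>\<in>F. c \<xi> * of_real (exp (\<xi> \<bullet> W y))) has_derivative
      (\<lambda>v. \<Sum>\<xi>\<in>F. c \<xi> * of_real (exp (\<xi> \<bullet> W x) * (\<xi> \<bullet> DW x v)))) (at x)"
    by (intro has_derivative_sum has_derivative_mult_right has_derivative_of_real exp_has_derivative assms(3))
qed (simp add: expsum_eq[OF assms(1,2)])

text \<open>The real and imaginary parts of a sum have the gradients \<open>\<Sum> Re c\<^sub>\<xi> e\<^sub>\<xi> \<xi>\<close> and \<open>\<Sum> Im c\<^sub>\<xi> e\<^sub>\<xi> \<xi>\<close>; the rest is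
  the bilinearity of \<open>\<sigma>\<close>.\<close>

lemma poisson_bracket_expsum:
  assumes F: "finite F" "supp c \<subseteq> F"
    and G: "finite G" "supp d \<subseteq> G"
    and x: "x \<in> M"
  shows "poisson_bracket \<omega> (expsum c) (expsum d) x
    = (\<Sum>\<xi>\<in>F. \<Sum>\<eta>\<in>G. c \<xi> * d \<eta> * of_real (\<sigma> \<xi> \<eta> * exp ((\<xi> + \<eta>) \<bullet> W x)))"
proof -
  let ?e = "\<lambda>\<xi>. exp (\<xi> \<bullet> W x)"
  let ?a = "\<lambda>p F c. \<Sum>\<xi>\<in>F. (p (c \<xi> :: complex) * ?e \<xi>) *\<^sub>R \<xi>"
  have D: "((\<lambda>y. Re (expsum c y)) has_derivative (\<lambda>v. ?a Re F c \<bullet> DW x v)) (at x)"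
    "((\<lambda>y. Im (expsum c y)) has_derivative (\<lambda>v. ?a Im F c \<bullet> DW x v)) (at x)"
    if F: "finite F" "supp c \<subseteq> F" for F c
    using has_derivative_Re[OF expsum_has_derivative[OF F x]] has_derivative_Im[OF expsum_has_derivative[OF F x]]
    by (simp_all add: inner_sum_left mult.assoc)
  note B = real_poisson_bracket_chart[OF x D(1)[OF F] D(1)[OF G]]
    real_poisson_bracket_chart[OF x D(1)[OF F] D(2)[OF G]]
    real_poisson_bracket_chart[OF x D(2)[OF F] D(1)[OF G]]
    real_poisson_bracket_chart[OF x D(2)[OF F] D(2)[OF G]]
  show ?thesis
    unfolding poisson_bracket_def Let_def B \<sigma>_sum_sum
    by (auto simp: complex_eq_iff sum_subtractf[symmetric] sum.distrib[symmetric] inner_add_left exp_add algebra_simps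
        intro!: sum.cong)
qed

lemma smooth_on_expsum:
  assumes F: "finite F" "supp c \<subseteq> F"
  shows "smooth_on M (expsum c)"
proof (rule smooth_on_cong[OF open_M])
  show "smooth_on M (\<lambda>x. \<Sum>\<xi>\<in>F. exp (\<xi> \<bullet> W x) *\<^sub>R c \<xi>)"
    by (intro smooth_on_sum open_M smooth_on_bounded_linear[OF bounded_linear_scaleR_left] smooth_on_exp
        smooth_on_bounded_linear[OF bounded_linear_inner_right] smooth_W)
qed (simp add: expsum_eq[OF F] scaleR_conv_of_real mult.commute)

subsection \<open>Twisted convolution\<close>

definition phase :: "real \<Rightarrow> 'a \<Rightarrow> 'a \<Rightarrow> complex" where
  "phase h \<xi> \<eta> = exp (\<i> * of_real (h * \<sigma> \<xi> \<eta> / 2))"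

text \<open>Both exponents are \<open>\<sigma> \<xi> \<eta> + \<sigma> \<xi> \<zeta> + \<sigma> \<eta> \<zeta>\<close>, up to the factor \<open>i h / 2\<close>. This is what makes the
  convolution below associative.\<close>

lemma phase_cocycle: "phase h \<xi> \<eta> * phase h (\<xi> + \<eta>) \<zeta> = phase h \<eta> \<zeta> * phase h \<xi> (\<eta> + \<zeta>)"
  by (simp add: phase_def exp_add[symmetric] \<sigma>_add_left \<sigma>_add_right algebra_simps add_divide_distrib)

text \<open>The coefficients of the product of two exponential sums. For \<open>h = 0\<close> the phases are \<open>1\<close>, and this is
  the convolution that belongs to the pointwise product.\<close>

definition tconv :: "real \<Rightarrow> ('a \<Rightarrow> complex) \<Rightarrow> ('a \<Rightarrow> complex) \<Rightarrow> 'a \<Rightarrow> complex" where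
  "tconv h c d \<zeta> = (\<Sum>\<xi>\<in>supp c. \<Sum>\<eta>\<in>supp d. if \<xi> + \<eta> = \<zeta> then c \<xi> * d \<eta> * phase h \<xi> \<eta> else 0)"

abbreviation sumset :: "'a set \<Rightarrow> 'a set \<Rightarrow> 'a set" where
  "sumset F G \<equiv> (\<lambda>(\<xi>, \<eta>). \<xi> + \<eta>) ` (F \<times> G)"

lemma tconv_eq:
  assumes "finite F" "supp c \<subseteq> F" "finite G" "supp d \<subseteq> G"
  shows "tconv h c d \<zeta> = (\<Sum>\<xi>\<in>F. \<Sum>\<eta>\<in>G. if \<xi> + \<eta> = \<zeta> then c \<xi> * d \<eta> * phase h \<xi> \<eta> else 0)"
  unfolding tconv_def
proof (rule sum.mono_neutral_cong_left[OF assms(1,2)])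
  show "(\<Sum>\<eta>\<in>supp d. if \<xi> + \<eta> = \<zeta> then c \<xi> * d \<eta> * phase h \<xi> \<eta> else 0)
      = (\<Sum>\<eta>\<in>G. if \<xi> + \<eta> = \<zeta> then c \<xi> * d \<eta> * phase h \<xi> \<eta> else 0)" for \<xi>
    by (rule sum.mono_neutral_left[OF assms(3,4)]) auto
qed (simp cong: if_cong)

lemma supp_tconv:
  assumes "supp c \<subseteq> F" "supp d \<subseteq> G"
  shows "supp (tconv h c d) \<subseteq> sumset F G"
proof
  fix \<zeta> assume \<zeta>: "\<zeta> \<in> supp (tconv h c d)"
  show "\<zeta> \<in> sumset F G"
  proof (rule ccontr)
    assume "\<zeta> \<notin> sumset F G"
    then have "\<xi> + \<eta> \<noteq> \<zeta>" if "\<xi> \<in> supp c" "\<eta> \<in> supp d" for \<xi> \<eta>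
      using that assms by force
    then have "tconv h c d \<zeta> = 0" unfolding tconv_def by simp
    with \<zeta> show False by simp
  qed
qed

text \<open>Sums over the frequencies of a product become double sums. With \<open>\<Psi> \<zeta> = exp (\<zeta> \<bullet> W x)\<close> this evaluates
  the product at a point; in a product of three factors, \<open>\<Psi>\<close> collects the contribution of the third.\<close>

lemma sum_tconv:
  assumes F: "finite F" "supp c \<subseteq> F" and G: "finite G" "supp d \<subseteq> G"
    and H: "finite H" "sumset F G \<subseteq> H"
  shows "(\<Sum>\<zeta>\<in>H. tconv h c d \<zeta> * \<Psi> \<zeta>) = (\<Sum>\<xi>\<in>F. \<Sum>\<eta>\<in>G. c \<xi> * d \<eta> * phase h \<xi> \<eta> * \<Psi> (\<xi> + \<eta>))"
proof -
  have "(\<Sum>\<zeta>\<in>H. tconv h c d \<zeta> * \<Psi> \<zeta>)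
      = (\<Sum>\<zeta>\<in>H. \<Sum>\<xi>\<in>F. \<Sum>\<eta>\<in>G. if \<xi> + \<eta> = \<zeta> then c \<xi> * d \<eta> * phase h \<xi> \<eta> * \<Psi> \<zeta> else 0)"
    unfolding tconv_eq[OF F G] sum_distrib_right by (intro sum.cong refl) auto
  also have "\<dots> = (\<Sum>\<xi>\<in>F. \<Sum>\<eta>\<in>G. \<Sum>\<zeta>\<in>H. if \<xi> + \<eta> = \<zeta> then c \<xi> * d \<eta> * phase h \<xi> \<eta> * \<Psi> \<zeta> else 0)"
    by (subst sum.swap) (intro sum.cong refl sum.swap)
  also have "\<dots> = (\<Sum>\<xi>\<in>F. \<Sum>\<eta>\<in>G. c \<xi> * d \<eta> * phase h \<xi> \<eta> * \<Psi> (\<xi> + \<eta>))"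
  proof (intro sum.cong refl)
    fix \<xi> \<eta> assume "\<xi> \<in> F" "\<eta> \<in> G"
    then have "\<xi> + \<eta> \<in> H" using H(2) by force
    then show "(\<Sum>\<zeta>\<in>H. if \<xi> + \<eta> = \<zeta> then c \<xi> * d \<eta> * phase h \<xi> \<eta> * \<Psi> \<zeta> else 0)
        = c \<xi> * d \<eta> * phase h \<xi> \<eta> * \<Psi> (\<xi> + \<eta>)"
      by (simp add: sum.delta'[OF H(1)])
  qed
  finally show ?thesis .
qed

lemma finite_supp_tconv: "finite (supp c) \<Longrightarrow> finite (supp d) \<Longrightarrow> finite (supp (tconv h c d))"
  by (rule finite_subset[OF supp_tconv[OF order_refl order_refl]]) auto

lemma tconv_assoc:
  assumes F: "finite (supp c)" and G: "finite (supp d)" and K: "finite (supp e)"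
  shows "tconv h (tconv h c d) e = tconv h c (tconv h d e)"
proof
  fix \<zeta>
  let ?FG = "sumset (supp c) (supp d)" and ?GK = "sumset (supp d) (supp e)"
  have fin: "finite ?FG" "finite ?GK" using assms by auto
  have "tconv h (tconv h c d) e \<zeta>
      = (\<Sum>\<alpha>\<in>?FG. tconv h c d \<alpha> * (\<Sum>\<kappa>\<in>supp e. if \<alpha> + \<kappa> = \<zeta> then e \<kappa> * phase h \<alpha> \<kappa> else 0))"
    unfolding tconv_eq[OF fin(1) supp_tconv[OF order_refl order_refl] K order_refl] sum_distrib_left
    by (intro sum.cong refl) auto
  also have "\<dots> = (\<Sum>\<xi>\<in>supp c. \<Sum>\<eta>\<in>supp d. \<Sum>\<kappa>\<in>supp e.
      if \<xi> + \<eta> + \<kappa> = \<zeta> then c \<xi> * d \<eta> * e \<kappa> * (phase h \<xi> \<eta> * phase h (\<xi> + \<eta>) \<kappa>) else 0)"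
    unfolding sum_tconv[OF F order_refl G order_refl fin(1) order_refl] unfolding sum_distrib_left
    by (intro sum.cong refl) auto
  also have "\<dots> = (\<Sum>\<xi>\<in>supp c. c \<xi> * (\<Sum>\<eta>\<in>supp d. \<Sum>\<kappa>\<in>supp e.
      d \<eta> * e \<kappa> * phase h \<eta> \<kappa> * (if \<xi> + (\<eta> + \<kappa>) = \<zeta> then phase h \<xi> (\<eta> + \<kappa>) else 0)))"
    unfolding phase_cocycle sum_distrib_left by (intro sum.cong refl) (auto simp: add.assoc)
  also have "\<dots> = (\<Sum>\<xi>\<in>supp c. c \<xi> * (\<Sum>\<beta>\<in>?GK. tconv h d e \<beta> * (if \<xi> + \<beta> = \<zeta> then phase h \<xi> \<beta> else 0)))"
    by (simp only: sum_tconv[OF G order_refl K order_refl fin(2) order_refl])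
  also have "\<dots> = tconv h c (tconv h d e) \<zeta>"
    unfolding tconv_eq[OF F order_refl fin(2) supp_tconv[OF order_refl order_refl]] sum_distrib_left
    by (intro sum.cong refl) auto
  finally show "tconv h (tconv h c d) e \<zeta> = tconv h c (tconv h d e) \<zeta>" .
qed

lemma finite_supp_add: "finite (supp c) \<Longrightarrow> finite (supp d) \<Longrightarrow> finite (supp (\<lambda>\<xi>. c \<xi> + d \<xi>))"
  by (rule finite_subset[of _ "supp c \<union> supp d"]) auto

lemma finite_supp_scale: "finite (supp c) \<Longrightarrow> finite (supp (\<lambda>\<xi>. s * c \<xi>))"
  by (rule finite_subset[of _ "supp c"]) auto

lemma tconv_add_left:
  assumes "finite (supp c)" "finite (supp c')" "finite (supp d)"
  shows "tconv h (\<lambda>\<xi>. c \<xi> + c' \<xi>) d = (\<lambda>\<xi>. tconv h c d \<xi> + tconv h c' d \<xi>)"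
proof
  fix \<zeta>
  let ?F = "supp c \<union> supp c'"
  have F: "finite ?F" "supp (\<lambda>\<xi>. c \<xi> + c' \<xi>) \<subseteq> ?F" "supp c \<subseteq> ?F" "supp c' \<subseteq> ?F" using assms by auto
  note e = tconv_eq[OF F(1) _ assms(3) order_refl]
  show "tconv h (\<lambda>\<xi>. c \<xi> + c' \<xi>) d \<zeta> = tconv h c d \<zeta> + tconv h c' d \<zeta>"
    unfolding e[OF F(2)] e[OF F(3)] e[OF F(4)] sum.distrib[symmetric]
    by (intro sum.cong refl) (auto simp: algebra_simps)
qed

lemma tconv_add_right:
  assumes "finite (supp c)" "finite (supp d)" "finite (supp d')"
  shows "tconv h c (\<lambda>\<xi>. d \<xi> + d' \<xi>) = (\<lambda>\<xi>. tconv h c d \<xi> + tconv h c d' \<xi>)"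
proof
  fix \<zeta>
  let ?F = "supp d \<union> supp d'"
  have F: "finite ?F" "supp (\<lambda>\<xi>. d \<xi> + d' \<xi>) \<subseteq> ?F" "supp d \<subseteq> ?F" "supp d' \<subseteq> ?F" using assms by auto
  note e = tconv_eq[OF assms(1) order_refl F(1)]
  show "tconv h c (\<lambda>\<xi>. d \<xi> + d' \<xi>) \<zeta> = tconv h c d \<zeta> + tconv h c d' \<zeta>"
    unfolding e[OF F(2)] e[OF F(3)] e[OF F(4)] sum.distrib[symmetric]
    by (intro sum.cong refl) (auto simp: algebra_simps)
qed

lemma tconv_scale_left: "tconv h (\<lambda>\<xi>. s * c \<xi>) d = (\<lambda>\<xi>. s * tconv h c d \<xi>)"
  by (cases "s = 0") (simp_all add: tconv_def fun_eq_iff sum_distrib_left if_distrib[of "\<lambda>x. s * x"] mult_ac cong: if_cong)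

lemma tconv_scale_right: "tconv h c (\<lambda>\<xi>. s * d \<xi>) = (\<lambda>\<xi>. s * tconv h c d \<xi>)"
  by (cases "s = 0") (simp_all add: tconv_def fun_eq_iff sum_distrib_left if_distrib[of "\<lambda>x. s * x"] mult_ac cong: if_cong)

lemma expsum_zero: "expsum (\<lambda>\<xi>. 0) = (\<lambda>x. 0)"
  by (auto simp: expsum_def)

lemma expsum_add:
  assumes "finite (supp c)" "finite (supp d)"
  shows "expsum (\<lambda>\<xi>. c \<xi> + d \<xi>) = (\<lambda>x. expsum c x + expsum d x)"
proof
  fix x
  let ?F = "supp c \<union> supp d"
  have F: "finite ?F" "supp (\<lambda>\<xi>. c \<xi> + d \<xi>) \<subseteq> ?F" "supp c \<subseteq> ?F" "supp d \<subseteq> ?F" using assms by auto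
  show "expsum (\<lambda>\<xi>. c \<xi> + d \<xi>) x = expsum c x + expsum d x"
    using expsum_eq[OF F(1,2)] expsum_eq[OF F(1,3)] expsum_eq[OF F(1,4)]
    by (cases "x \<in> M") (simp_all add: sum.distrib distrib_right expsum_off)
qed

lemma expsum_scale: "expsum (\<lambda>\<xi>. s * c \<xi>) = (\<lambda>x. s * expsum c x)"
  unfolding expsum_def by (cases "s = 0") (auto simp: sum_distrib_left mult.assoc)

lemma expsum_tconv:
  assumes "finite F" "supp c \<subseteq> F" "finite G" "supp d \<subseteq> G" "x \<in> M"
  shows "expsum (tconv h c d) x
    = (\<Sum>\<xi>\<in>F. \<Sum>\<eta>\<in>G. c \<xi> * d \<eta> * phase h \<xi> \<eta> * of_real (exp ((\<xi> + \<eta>) \<bullet> W x)))"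
  using assms
  by (subst expsum_eq[OF _ supp_tconv[OF assms(2,4)]])
    (auto intro!: sum_tconv[OF assms(1-4)])

definition expspace :: "('a \<Rightarrow> complex) set" where
  "expspace = {expsum c |c. finite (supp c)}"

text \<open>Well defined on \<open>expspace\<close> by the independence of the exponentials.\<close>

definition coeff :: "('a \<Rightarrow> complex) \<Rightarrow> 'a \<Rightarrow> complex" where
  "coeff f = (THE c. finite (supp c) \<and> f = expsum c)"

definition expmul :: "real \<Rightarrow> ('a \<Rightarrow> complex) \<Rightarrow> ('a \<Rightarrow> complex) \<Rightarrow> 'a \<Rightarrow> complex" where
  "expmul h f g = expsum (tconv h (coeff f) (coeff g))"

lemma coeff_expsum: "finite (supp c) \<Longrightarrow> coeff (expsum c) = c"
  unfolding coeff_def by (rule the_equality) (use expsum_inj in auto)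

lemma expmul_expsum:
  "finite (supp c) \<Longrightarrow> finite (supp d) \<Longrightarrow> expmul h (expsum c) (expsum d) = expsum (tconv h c d)"
  by (simp add: expmul_def coeff_expsum)

lemma function_algebra_expspace: "function_algebra M expspace (expmul h)"
proof
  show "(\<lambda>x. 0) \<in> expspace"
    by (auto simp: expspace_def expsum_zero intro!: exI[of _ "\<lambda>\<xi>. 0"])
qed (auto simp: expspace_def expsum_off expmul_expsum finite_supp_tconv finite_supp_add finite_supp_scale
    expsum_add[symmetric] expsum_scale[symmetric] tconv_assoc tconv_add_left tconv_add_right
    tconv_scale_left tconv_scale_right)

subsection \<open>Families with converging coefficients\<close>

text \<open>One finite set \<open>F\<close> of frequencies serves for all \<open>h\<close>, so that convergence of each coefficient is
  enough for every limit. For \<open>h \<le> 0\<close> the coefficients are zero, because families are encoded as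
  functions of all real \<open>h\<close> that vanish there.\<close>

definition convergent_family :: "(real \<Rightarrow> 'a \<Rightarrow> complex) \<Rightarrow> ('a \<Rightarrow> complex) \<Rightarrow> 'a set \<Rightarrow> bool" where
  "convergent_family c l F \<longleftrightarrow> finite F \<and> (\<forall>h. supp (c h) \<subseteq> F) \<and> (\<forall>h\<le>0. c h = (\<lambda>\<xi>. 0))
     \<and> (\<forall>\<xi>. ((\<lambda>h. c h \<xi>) \<longlongrightarrow> l \<xi>) (at_right 0))"

lemma convergent_family_finite_supp:
  assumes "convergent_family c l F"
  shows "finite (supp (c h))"
proof (rule finite_subset)
  show "supp (c h) \<subseteq> F" "finite F" using assms unfolding convergent_family_def by auto
qed

lemma convergent_family_supp_limit:
  assumes "convergent_family c l F"
  shows "supp l \<subseteq> F"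
proof
  fix \<xi> assume \<xi>: "\<xi> \<in> supp l"
  show "\<xi> \<in> F"
  proof (rule ccontr)
    assume "\<xi> \<notin> F"
    then have "(\<lambda>h. c h \<xi>) = (\<lambda>h. 0)" using assms by (auto simp: convergent_family_def)
    with assms have "((\<lambda>h::real. 0) \<longlongrightarrow> l \<xi>) (at_right 0)" unfolding convergent_family_def by metis
    with \<xi> show False using tendsto_const_iff[of "at_right (0::real)" 0 "l \<xi>"] by simp
  qed
qed

lemma convergent_family_tconv:
  assumes c: "convergent_family c l F" and d: "convergent_family d m G"
  shows "convergent_family (\<lambda>h. tconv h (c h) (d h)) (tconv 0 l m) (sumset F G)"
proof -
  have F: "finite F" "\<And>h. supp (c h) \<subseteq> F" "supp l \<subseteq> F"
    and G: "finite G" "\<And>h. supp (d h) \<subseteq> G" "supp m \<subseteq> G"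
    using c d convergent_family_supp_limit by (auto simp: convergent_family_def)
  have lim: "((\<lambda>h. c h \<xi>) \<longlongrightarrow> l \<xi>) (at_right 0)" "((\<lambda>h. d h \<xi>) \<longlongrightarrow> m \<xi>) (at_right 0)"
 for \<xi>
    using c d unfolding convergent_family_def by auto
  have phase_lim: "((\<lambda>h. phase h \<xi> \<eta>) \<longlongrightarrow> phase 0 \<xi> \<eta>) (at_right 0)" for \<xi> \<eta>
    unfolding phase_def by (intro tendsto_intros) auto
  have "((\<lambda>h. tconv h (c h) (d h) \<zeta>) \<longlongrightarrow> tconv 0 l m \<zeta>) (at_right 0)" for \<zeta>
    unfolding tconv_eq[OF F(1,2) G(1,2)] tconv_eq[OF F(1,3) G(1,3)]
    by (intro tendsto_sum) (auto intro!: tendsto_mult lim phase_lim)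
  moreover have "supp (tconv h (c h) (d h)) \<subseteq> sumset F G" for h
    by (rule supp_tconv[OF F(2) G(2)])
  moreover have "tconv h (c h) (d h) = (\<lambda>\<xi>. 0)" if "h \<le> 0" for h
    using c that by (auto simp: convergent_family_def tconv_def)
  ultimately show ?thesis using F(1) G(1) by (simp add: convergent_family_def)
qed

lemma expsum_tendsto:
  assumes "convergent_family c l F" "x \<in> M"
  shows "((\<lambda>h. expsum (c h) x) \<longlongrightarrow> expsum l x) (at_right 0)"
proof -
  have F: "finite F" "\<And>h. supp (c h) \<subseteq> F" "supp l \<subseteq> F"
    using assms convergent_family_supp_limit by (auto simp: convergent_family_def)
  show ?thesis
    unfolding expsum_eq[OF F(1,2) assms(2)] expsum_eq[OF F(1,3) assms(2)]
    using assms(1) by (auto intro!: tendsto_intros simp: convergent_family_def)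
qed

definition expfamilies :: "(real \<Rightarrow> 'a \<Rightarrow> complex) set" where
  "expfamilies = {\<lambda>h. expsum (c h) |c. \<exists>l F. convergent_family c l F}"

lemma expfamiliesI: "convergent_family c l F \<Longrightarrow> (\<lambda>h. expsum (c h)) \<in> expfamilies"
  unfolding expfamilies_def by blast

definition classical_limit :: "(real \<Rightarrow> 'a \<Rightarrow> complex) \<Rightarrow> 'a \<Rightarrow> complex" where
  "classical_limit f x = (if x \<in> M then Lim (at_right 0) (\<lambda>h. f h x) else 0)"

lemma classical_limit_expsum:
  assumes "convergent_family c l F"
  shows "classical_limit (\<lambda>h. expsum (c h)) = expsum l"
proof
  show "classical_limit (\<lambda>h. expsum (c h)) x = expsum l x" for x
    using tendsto_Lim[OF _ expsum_tendsto[OF assms]] by (auto simp: classical_limit_def expsum_off)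
qed

lemma family_mul_expsum:
  assumes "convergent_family c l F" "convergent_family d m G"
  shows "family_mul {0<..} expmul (\<lambda>h. expsum (c h)) (\<lambda>h. expsum (d h)) = (\<lambda>h. expsum (tconv h (c h) (d h)))"
proof
  fix h
  note assms[THEN convergent_family_finite_supp, of h]
  moreover have "tconv h (c h) (d h) = (\<lambda>\<xi>. 0)" if "h \<le> 0"
    using convergent_family_tconv[OF assms] that by (simp add: convergent_family_def)
  ultimately show "family_mul {0<..} expmul (\<lambda>h. expsum (c h)) (\<lambda>h. expsum (d h)) h = expsum (tconv h (c h) (d h))"
    by (simp add: family_mul_def expmul_expsum expsum_zero)
qed

text \<open>By antisymmetry of \<open>\<sigma>\<close> the numerator is \<open>exp (k h) - exp (- k h)\<close> with \<open>k = i \<sigma> \<xi> \<eta> / 2\<close>, whose derivative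
  at \<open>h = 0\<close> is \<open>2 k\<close>.\<close>

lemma phase_commutator_tendsto:
  "((\<lambda>h. (phase h \<xi> \<eta> - phase h \<eta> \<xi>) / of_real h) \<longlongrightarrow> \<i> * of_real (\<sigma> \<xi> \<eta>)) (at_right 0)"
proof -
  define k :: complex where "k = \<i> * of_real (\<sigma> \<xi> \<eta>) / 2"
  have "((\<lambda>z. exp (k * z) - exp (- (k * z))) has_field_derivative 2 * k) (at 0)"
    by (auto intro!: derivative_eq_intros)
  then have "((\<lambda>z. (exp (k * z) - exp (- (k * z))) / z) \<longlongrightarrow> 2 * k) (at 0)"
    by (simp add: DERIV_def)
  moreover have "filterlim (of_real :: real \<Rightarrow> complex) (at 0) (at_right 0)"
    by (auto simp: filterlim_at eventually_at_filter intro!: tendsto_eq_intros)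
  ultimately have "((\<lambda>h. (exp (k * of_real h) - exp (- (k * of_real h))) / of_real h) \<longlongrightarrow> 2 * k) (at_right (0::real))"
    by (rule filterlim_compose)
  then show ?thesis
    by (simp add: phase_def k_def \<sigma>_antisym[of \<eta> \<xi>] mult_ac)
qed

lemma commutator_tendsto:
  assumes c: "convergent_family c l F" and d: "convergent_family d m G" and x: "x \<in> M"
  shows "((\<lambda>h. (expsum (tconv h (c h) (d h)) x - expsum (tconv h (d h) (c h)) x) / of_real h)
    \<longlongrightarrow> \<i> * poisson_bracket \<omega> (expsum l) (expsum m) x) (at_right 0)"
proof -
  have F: "finite F" "\<And>h. supp (c h) \<subseteq> F" "supp l \<subseteq> F"
    and G: "finite G" "\<And>h. supp (d h) \<subseteq> G" "supp m \<subseteq> G"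
    using c d convergent_family_supp_limit by (auto simp: convergent_family_def)
  let ?e = "\<lambda>\<xi> \<eta>. complex_of_real (exp ((\<xi> + \<eta>) \<bullet> W x))"
  have "(expsum (tconv h (c h) (d h)) x - expsum (tconv h (d h) (c h)) x) / of_real h
      = (\<Sum>\<xi>\<in>F. \<Sum>\<eta>\<in>G. c h \<xi> * d h \<eta> * ((phase h \<xi> \<eta> - phase h \<eta> \<xi>) / of_real h) * ?e \<xi> \<eta>)" for h
  proof -
    have "expsum (tconv h (d h) (c h)) x = (\<Sum>\<xi>\<in>F. \<Sum>\<eta>\<in>G. d h \<eta> * c h \<xi> * phase h \<eta> \<xi> * ?e \<eta> \<xi>)"
      by (subst sum.swap) (rule expsum_tconv[OF G(1,2) F(1,2) x])
    then show ?thesis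
      unfolding expsum_tconv[OF F(1,2) G(1,2) x]
      by (simp add: sum_subtractf[symmetric] sum_divide_distrib algebra_simps diff_divide_distrib)
  qed
  moreover have "\<i> * poisson_bracket \<omega> (expsum l) (expsum m) x
      = (\<Sum>\<xi>\<in>F. \<Sum>\<eta>\<in>G. l \<xi> * m \<eta> * (\<i> * of_real (\<sigma> \<xi> \<eta>)) * ?e \<xi> \<eta>)"
    unfolding poisson_bracket_expsum[OF F(1,3) G(1,3) x]
    by (simp add: sum_distrib_left mult_ac)
  moreover have "((\<lambda>h. \<Sum>\<xi>\<in>F. \<Sum>\<eta>\<in>G. c h \<xi> * d h \<eta> * ((phase h \<xi> \<eta> - phase h \<eta> \<xi>) / of_real h) * ?e \<xi> \<eta>)
      \<longlongrightarrow> (\<Sum>\<xi>\<in>F. \<Sum>\<eta>\<in>G. l \<xi> * m \<eta> * (\<i> * of_real (\<sigma> \<xi> \<eta>)) * ?e \<xi> \<eta>)) (at_right 0)"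
    using c d by (intro tendsto_sum tendsto_mult tendsto_const phase_commutator_tendsto)
      (auto simp: convergent_family_def)
  ultimately show ?thesis by simp
qed

lemma berezin_quantization_chart:
  "berezin_quantization M \<omega> {0<..} (\<lambda>h. expspace) expmul expfamilies classical_limit"
proof (intro berezin_quantization.intro berezin_quantization_axioms.intro)
  show "symplectic_domain M \<omega>" by (rule symplectic_domain_axioms)
  show "(0::real) islimpt {0<..}"
    using trivial_limit_at_right_real[of 0] by (simp add: trivial_limit_within)
  show "function_algebra M expspace (expmul h)" for h by (rule function_algebra_expspace)
  show "expfamilies \<subseteq> families {0<..} (\<lambda>h. expspace)"
  proof
    fix f assume "f \<in> expfamilies"
    then obtain c l F where c: "convergent_family c l F" and f: "f = (\<lambda>h. expsum (c h))"
      by (auto simp: expfamilies_def)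
    note convergent_family_finite_supp[OF c]
    then show "f \<in> families {0<..} (\<lambda>h. expspace)"
      using c by (auto simp: families_def f expspace_def convergent_family_def expsum_zero)
  qed
  have "convergent_family (\<lambda>h \<xi>. 0) (\<lambda>\<xi>. 0) {}" by (simp add: convergent_family_def)
  from expfamiliesI[OF this] show "(\<lambda>h x. 0) \<in> expfamilies" by (simp add: expsum_zero)
  show "\<exists>f\<in>expfamilies. classical_limit f x1 \<noteq> classical_limit f x2"
    if x: "x1 \<in> M" "x2 \<in> M" "x1 \<noteq> x2" for x1 x2
  proof -
    \<comment> \<open>the constant family \<open>e\<^sub>\<delta>\<close> separates the two points, as \<open>\<delta> \<bullet> W x1 - \<delta> \<bullet> W x2 = \<delta> \<bullet> \<delta>\<close>\<close>
    define \<delta> where "\<delta> = W x1 - W x2"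
    define l :: "'a \<Rightarrow> complex" where "l = (\<lambda>\<xi>. if \<xi> = \<delta> then 1 else 0)"
    define c where "c h = (if h > 0 then l else (\<lambda>\<xi>. 0))" for h :: real
    have "((\<lambda>h. c h \<xi>) \<longlongrightarrow> l \<xi>) (at_right 0)" for \<xi>
      by (rule tendsto_eventually) (auto simp: c_def eventually_at_filter)
    then have c: "convergent_family c l {\<delta>}"
      by (auto simp: convergent_family_def c_def l_def)
    have e: "expsum l x = of_real (exp (\<delta> \<bullet> W x))" if "x \<in> M" for x
      by (subst expsum_eq[of "{\<delta>}"]) (auto simp: l_def that)
    have "\<delta> \<noteq> 0" using x inj_W by (auto simp: \<delta>_def inj_on_def)
    then have "\<delta> \<bullet> W x1 \<noteq> \<delta> \<bullet> W x2"
      by (metis \<delta>_def inner_diff_right inner_eq_zero_iff right_minus_eq)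
    then have "classical_limit (\<lambda>h. expsum (c h)) x1 \<noteq> classical_limit (\<lambda>h. expsum (c h)) x2"
      by (simp add: classical_limit_expsum[OF c] e x)
    then show ?thesis using expfamiliesI[OF c] by blast
  qed
  fix f assume "f \<in> expfamilies"
  then obtain c l F where c: "convergent_family c l F" and f: "f = (\<lambda>h. expsum (c h))"
    by (auto simp: expfamilies_def)
  have F: "finite F" "\<And>h. supp (c h) \<subseteq> F" "supp l \<subseteq> F"
    using c convergent_family_supp_limit by (auto simp: convergent_family_def)
  show "((\<lambda>h. f h x) \<longlongrightarrow> classical_limit f x) (at_right 0)" if "x \<in> M" for x
    unfolding f classical_limit_expsum[OF c] by (rule expsum_tendsto[OF c that])
  show "smooth_on M (classical_limit f)"
    unfolding f classical_limit_expsum[OF c] by (rule smooth_on_expsum[OF F(1,3)])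
  show "(\<lambda>h x. s * f h x) \<in> expfamilies" for s
  proof -
    have "convergent_family (\<lambda>h \<xi>. s * c h \<xi>) (\<lambda>\<xi>. s * l \<xi>) F"
      using c by (auto simp: convergent_family_def intro!: tendsto_intros)
    then show ?thesis unfolding f expsum_scale[symmetric] by (rule expfamiliesI)
  qed
  fix g assume "g \<in> expfamilies"
  then obtain d m G where d: "convergent_family d m G" and g: "g = (\<lambda>h. expsum (d h))"
    by (auto simp: expfamilies_def)
  have G: "finite G" "\<And>h. supp (d h) \<subseteq> G" "supp m \<subseteq> G"
    using d convergent_family_supp_limit by (auto simp: convergent_family_def)
  show "(\<lambda>h x. f h x + g h x) \<in> expfamilies"
  proof -
    have "supp (\<lambda>\<xi>. c h \<xi> + d h \<xi>) \<subseteq> supp (c h) \<union> supp (d h)" for h by auto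
    then have "supp (\<lambda>\<xi>. c h \<xi> + d h \<xi>) \<subseteq> F \<union> G" for h using F(2) G(2) by blast
    then have "convergent_family (\<lambda>h \<xi>. c h \<xi> + d h \<xi>) (\<lambda>\<xi>. l \<xi> + m \<xi>) (F \<union> G)"
      using c d by (auto simp: convergent_family_def intro!: tendsto_intros)
    then show ?thesis
      unfolding f g expsum_add[OF convergent_family_finite_supp[OF c] convergent_family_finite_supp[OF d], symmetric]
      by (rule expfamiliesI)
  qed
  note cd = family_mul_expsum[OF c d] convergent_family_tconv[OF c d]
  show "family_mul {0<..} expmul f g \<in> expfamilies"
    unfolding f g cd(1) by (rule expfamiliesI[OF cd(2)])
  fix x assume x: "x \<in> M"
  show "classical_limit (family_mul {0<..} expmul f g) x = classical_limit f x * classical_limit g x"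
    unfolding f g cd(1) classical_limit_expsum[OF cd(2)] classical_limit_expsum[OF c] classical_limit_expsum[OF d]
      expsum_tconv[OF F(1,3) G(1,3) x] expsum_eq[OF F(1,3) x] expsum_eq[OF G(1,3) x] sum_product
    by (intro sum.cong refl) (simp add: phase_def inner_add_left exp_add)
  show "((\<lambda>h. (family_mul {0<..} expmul f g h x - family_mul {0<..} expmul g f h x) / of_real h)
      \<longlongrightarrow> \<i> * poisson_bracket \<omega> (classical_limit f) (classical_limit g) x) (at_right 0)"
    unfolding f g cd(1) family_mul_expsum[OF d c] classical_limit_expsum[OF c] classical_limit_expsum[OF d]
    by (rule commutator_tendsto[OF c d x])
qed auto

end

section \<open>The Simanca form\<close>

definition herm :: "complex ^ 'n::finite \<Rightarrow> complex ^ 'n \<Rightarrow> complex" where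
  "herm u v = (\<Sum>j\<in>UNIV. u $ j * cnj (v $ j))"

lemma Re_herm: "Re (herm u v) = u \<bullet> v"
  by (simp add: herm_def inner_vec_def inner_complex_def)

lemma herm_cnj: "cnj (herm u v) = herm v u"
  by (simp add: herm_def mult.commute)

lemma Im_herm_commute: "Im (herm v u) = - Im (herm u v)"
  using arg_cong[OF herm_cnj[of u v], of Im] by simp

lemma Im_herm_self: "Im (herm u u) = 0"
  using arg_cong[OF herm_cnj[of u u], of Im] by simp

lemma bounded_bilinear_herm: "bounded_bilinear (herm :: complex ^ 'n::finite \<Rightarrow> _)"
proof -
  have "bilinear (herm :: complex ^ 'n::finite \<Rightarrow> _)"
    unfolding bilinear_def herm_def
    by (auto intro!: linearI simp: sum.distrib algebra_simps scaleR_sum_right)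
  then show ?thesis by (simp add: bilinear_conv_bounded_bilinear)
qed

lemmas herm_simps =
  bounded_bilinear.add_left[OF bounded_bilinear_herm] bounded_bilinear.add_right[OF bounded_bilinear_herm]
  bounded_bilinear.scaleR_left[OF bounded_bilinear_herm] bounded_bilinear.scaleR_right[OF bounded_bilinear_herm]

lemma simanca_potential_eq: "simanca_potential z = z \<bullet> z + ln (z \<bullet> z)"
  by (simp add: simanca_potential_def inner_vec_def sum_2 Let_def cmod_power2 inner_complex_def power2_eq_square[symmetric])

lemma inner_axis_complex: "axis j w \<bullet> (z :: complex ^ 'n::finite) = Re (w * cnj (z $ j))"
  by (simp add: inner_axis' inner_complex_def)

text \<open>For a potential \<open>\<Phi>(t)\<close> with \<open>t = z \<bullet> z\<close>, the derivatives by \<open>zbar\<^sub>k\<close> and then by \<open>z\<^sub>j\<close> are \<open>\<Phi>'(t) z\<^sub>k\<close> and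
  \<open>\<Phi>'(t) \<delta>\<^sub>j\<^sub>k + \<Phi>''(t) zbar\<^sub>j z\<^sub>k\<close>. Here \<open>\<Phi>(t) = t + ln t\<close>, so that \<open>\<Phi>'(t) = 1 + 1/t\<close> and
  \<open>\<Phi>''(t) = - 1/t\<^sup>2\<close>.\<close>

lemma d_dzbar_potential:
  assumes "z \<noteq> 0"
  shows "d_dzbar k (\<lambda>w. of_real (simanca_potential w)) z = of_real (1 + 1 / (z \<bullet> z)) * z $ k"
proof -
  have D: "((\<lambda>w. complex_of_real (simanca_potential w)) has_derivative
      (\<lambda>v. of_real (2 * (1 + 1 / (z \<bullet> z)) * (v \<bullet> z)))) (at z)"
    unfolding simanca_potential_eq
    using assms by (auto intro!: derivative_eq_intros simp: inner_commute field_simps fun_eq_iff)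
  show ?thesis
    unfolding d_dzbar_def frechet_derivative_at[symmetric, OF D]
    by (simp add: inner_axis_complex complex_eq_iff)
qed

lemma d_dz_d_dzbar_potential:
  assumes "z \<noteq> 0"
  shows "d_dz j (d_dzbar k (\<lambda>w. of_real (simanca_potential w))) z
    = of_real (1 + 1 / (z \<bullet> z)) * (if j = k then 1 else 0) - of_real (1 / (z \<bullet> z)\<^sup>2) * (cnj (z $ j) * z $ k)"
proof -
  have "((\<lambda>w. complex_of_real (1 + 1 / (w \<bullet> w)) * w $ k) has_derivative
      (\<lambda>v. of_real (1 + 1 / (z \<bullet> z)) * v $ k - of_real (2 * (v \<bullet> z) / (z \<bullet> z)\<^sup>2) * z $ k)) (at z)"
    using assms by (auto intro!: derivative_eq_intros bounded_linear_imp_has_derivative[OF bounded_linear_vec_nth]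
      simp: inner_commute power2_eq_square divide_inverse algebra_simps)
  then have D: "(d_dzbar k (\<lambda>w. of_real (simanca_potential w)) has_derivative
      (\<lambda>v. of_real (1 + 1 / (z \<bullet> z)) * v $ k - of_real (2 * (v \<bullet> z) / (z \<bullet> z)\<^sup>2) * z $ k)) (at z)"
    by (rule has_derivative_transform_within_open[where s = "- {0}"]) (use assms d_dzbar_potential in auto)
  have "axis j w $ k = (if j = k then w else 0)" for w :: complex
    by (simp add: axis_def)
  then show ?thesis
    unfolding d_dz_def frechet_derivative_at[symmetric, OF D]
    by (auto simp: inner_axis_complex complex_eq_iff algebra_simps add_divide_distrib diff_divide_distrib)
qed

lemma simanca_form_eq:
  assumes "z \<noteq> 0"
  shows "simanca_form z u v
    = - ((1 + 1 / (z \<bullet> z)) * Im (herm u v) - Im (herm u z * cnj (herm v z)) / (z \<bullet> z)\<^sup>2) / pi"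
proof -
  define a b where "a = 1 + 1 / (z \<bullet> z)" and "b = 1 / (z \<bullet> z)\<^sup>2"
  have "ddbar (\<lambda>w. of_real (simanca_potential w)) z u v
      = 2 * \<i> * of_real (a * Im (herm u v) - b * Im (herm u z * cnj (herm v z)))"
    unfolding ddbar_def d_dz_d_dzbar_potential[OF assms] a_def[symmetric] b_def[symmetric]
    by (simp add: sum_2 herm_def complex_eq_iff) (simp add: algebra_simps)
  then show ?thesis
    unfolding simanca_form_def by (simp add: a_def b_def divide_simps)
qed

definition simanca_chart :: "complex ^ 2 \<Rightarrow> complex ^ 2" where
  "simanca_chart z = sqrt (1 + 1 / (z \<bullet> z)) *\<^sub>R z"

text \<open>This is \<open>i / (2 \<pi>) \<Sum> dw\<^sub>j \<and> dwbar\<^sub>j\<close>, the form of the potential \<open>|w|\<^sup>2\<close>.\<close>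

definition flat_form :: "complex ^ 'n::finite \<Rightarrow> complex ^ 'n \<Rightarrow> real" where
  "flat_form u v = - Im (herm u v) / pi"

lemma bilinear_flat_form: "bilinear (flat_form :: complex ^ 'n::finite \<Rightarrow> _)"
  unfolding bilinear_def flat_form_def by (auto intro!: linearI simp: herm_simps add_divide_distrib)

lemma open_punctured: "open (UNIV - {0 :: complex ^ 2})"
  by (simp add: open_delete)

lemma smooth_on_inner_self: "smooth_on (UNIV - {0}) (\<lambda>z :: complex ^ 2. z \<bullet> z)"
  by (intro smooth_on_bounded_bilinear[OF bounded_bilinear_inner] smooth_on_id open_punctured)

lemma smooth_on_simanca_chart: "smooth_on (UNIV - {0}) simanca_chart"
proof -
  have "smooth_on (UNIV - {0}) (\<lambda>z :: complex ^ 2. 1 + (z \<bullet> z) powr - 1)"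
    by (intro smooth_on_add smooth_on_const smooth_on_powr smooth_on_inner_self open_punctured) auto
  then have "smooth_on (UNIV - {0}) (\<lambda>z :: complex ^ 2. (1 + (z \<bullet> z) powr - 1) powr (1 / 2))"
    by (rule smooth_on_powr[OF open_punctured]) (auto intro: add_pos_nonneg)
  then have "smooth_on (UNIV - {0}) (\<lambda>z :: complex ^ 2. (1 + (z \<bullet> z) powr - 1) powr (1 / 2) *\<^sub>R z)"
    by (intro smooth_on_bounded_bilinear[OF bounded_bilinear_scaleR] smooth_on_id open_punctured)
  then show ?thesis
    by (rule smooth_on_cong[OF open_punctured])
      (simp add: simanca_chart_def powr_half_sqrt powr_minus_divide)
qed

text \<open>The chart satisfies \<open>|w(z)|\<^sup>2 = |z|\<^sup>2 + 1\<close>, so that its value determines \<open>|z|\<close> and with it the factor by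
  which \<open>z\<close> is scaled.\<close>

lemma inj_on_simanca_chart: "inj_on simanca_chart (UNIV - {0})"
proof (rule inj_onI)
  fix z w :: "complex ^ 2"
  assume z: "z \<in> UNIV - {0}" and w: "w \<in> UNIV - {0}" and eq: "simanca_chart z = simanca_chart w"
  have n: "simanca_chart z \<bullet> simanca_chart z = z \<bullet> z + 1" if "z \<noteq> 0" for z :: "complex ^ 2"
  proof -
    have "z \<bullet> z > 0" using that by simp
    then show ?thesis by (simp add: simanca_chart_def field_simps)
  qed
  have "z \<bullet> z = w \<bullet> w" using n[of z] n[of w] z w eq by simp
  moreover have "sqrt (1 + 1 / (w \<bullet> w)) > 0" using w by (simp add: add_pos_pos)
  ultimately show "z = w" using eq by (simp add: simanca_chart_def)
qed

text \<open>With \<open>s = sqrt (\<Phi>'(r))\<close> and \<open>r = |z|\<^sup>2\<close>, the derivative of \<open>s z\<close> is \<open>u \<mapsto> s u + 2 s' (u \<bullet> z) z\<close>. In the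
  imaginary part of the hermitian product of two such vectors the term with \<open>s'\<^sup>2\<close> drops out, as
  the hermitian square of \<open>z\<close> is real. The factor \<open>s\<^sup>2\<close> is \<open>\<Phi>'\<close>, and the mixed terms have the factor
  \<open>2 s s' = \<Phi>''\<close>.\<close>

lemma simanca_form_pullback:
  assumes z: "z \<noteq> 0"
  shows "simanca_form z u v
    = flat_form (frechet_derivative simanca_chart (at z) u) (frechet_derivative simanca_chart (at z) v)"
proof -
  define r where "r = z \<bullet> z"
  define s where "s = sqrt (1 + 1 / r)"
  have r: "r > 0" using z by (simp add: r_def)
  then have s: "s > 0" "s * s = 1 + 1 / r" by (simp_all add: s_def add_pos_pos)
  have s_alt: "sqrt ((1 + r) / r) = s" using r by (simp add: s_def add_divide_distrib add.commute)
  \<comment> \<open>twice the derivative of \<open>s\<close> by \<open>r\<close>\<close>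
  define t where "t = - 1 / (s * r\<^sup>2)"
  have "(simanca_chart has_derivative (\<lambda>u. s *\<^sub>R u + (t * (u \<bullet> z)) *\<^sub>R z)) (at z)"
    unfolding simanca_chart_def[abs_def]
    using r s(1) z by (auto intro!: derivative_eq_intros
      simp: r_def[symmetric] s_def[symmetric] s_alt t_def inner_commute power2_eq_square field_simps add_pos_pos)
  note D = frechet_derivative_at[symmetric, OF this]
  have "Im (herm (s *\<^sub>R u + (t * (u \<bullet> z)) *\<^sub>R z) (s *\<^sub>R v + (t * (v \<bullet> z)) *\<^sub>R z))
      = s * s * Im (herm u v) + s * t * ((v \<bullet> z) * Im (herm u z) - (u \<bullet> z) * Im (herm v z))"
    using Im_herm_commute[of v z] Im_herm_self[of z]
    by (simp add: herm_simps algebra_simps)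
  also have "s * t = - 1 / r\<^sup>2" using s(1) by (simp add: t_def)
  finally have "Im (herm (s *\<^sub>R u + (t * (u \<bullet> z)) *\<^sub>R z) (s *\<^sub>R v + (t * (v \<bullet> z)) *\<^sub>R z))
      = (1 + 1 / r) * Im (herm u v) - Im (herm u z * cnj (herm v z)) / r\<^sup>2"
    by (simp add: Re_herm s algebra_simps diff_divide_distrib)
  then show ?thesis
    unfolding D simanca_form_eq[OF z] flat_form_def r_def[symmetric] by simp
qed

text \<open>In the cyclic sum, the terms with the third derivative of \<open>\<Phi>\<close> and those with the second one vanish
  separately. Writing \<open>a, b, c\<close> for the hermitian products of \<open>u, v, w\<close> with \<open>z\<close>, the former vanish by
  \<open>Re a Im (b cnj c) + Re b Im (c cnj a) + Re c Im (a cnj b) = 0\<close>, and the latter by the conjugate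
  symmetry of the hermitian product.\<close>

lemma simanca_closed:
  assumes z: "z \<noteq> 0"
  shows "frechet_derivative (\<lambda>y. simanca_form y v w) (at z) u
    + frechet_derivative (\<lambda>y. simanca_form y w u) (at z) v
    + frechet_derivative (\<lambda>y. simanca_form y u v) (at z) w = 0"
proof -
  define r where "r = z \<bullet> z"
  have r: "r > 0" using z by (simp add: r_def)
  define g where "g x y = Im (herm x z * cnj (herm y z))" for x y
  define g' where "g' u x y = Im (herm x u * cnj (herm y z)) + Im (herm x z * cnj (herm y u))" for u x y
  have D: "frechet_derivative (\<lambda>y. simanca_form y v w) (at z) u
      = (2 * (u \<bullet> z) / r\<^sup>2 * Im (herm v w) + g' u v w / r\<^sup>2 - 4 * (u \<bullet> z) / r ^ 3 * g v w) / pi" for u v w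
  proof -
    have "((\<lambda>y. 1 / (y \<bullet> y)) has_derivative (\<lambda>u. - (2 * (u \<bullet> z) / r\<^sup>2))) (at z)"
      using r by (auto intro!: derivative_eq_intros simp: r_def[symmetric] inner_commute power2_eq_square fun_eq_iff field_simps)
    moreover have "((\<lambda>y. 1 / (y \<bullet> y)\<^sup>2) has_derivative (\<lambda>u. - (4 * (u \<bullet> z) / r ^ 3))) (at z)"
      using r by (auto intro!: derivative_eq_intros simp: r_def[symmetric] inner_commute power2_eq_square power3_eq_cube fun_eq_iff field_simps)
    moreover have "((\<lambda>y. Im (herm v y * cnj (herm w y))) has_derivative (\<lambda>u. g' u v w)) (at z)"
      unfolding g'_def
      by (auto intro!: derivative_eq_intros bounded_linear_imp_has_derivative
          bounded_bilinear.bounded_linear_right[OF bounded_bilinear_herm] simp: algebra_simps)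
    ultimately have "((\<lambda>y. (1 / (y \<bullet> y)\<^sup>2 * Im (herm v y * cnj (herm w y)) - (1 + 1 / (y \<bullet> y)) * Im (herm v w)) / pi)
      has_derivative (\<lambda>u. ((1 / r\<^sup>2 * g' u v w + - (4 * (u \<bullet> z) / r ^ 3) * g v w) - (0 + - (2 * (u \<bullet> z) / r\<^sup>2)) * Im (herm v w)) / pi)) (at z)"
      unfolding r_def g_def
      by (intro bounded_linear.has_derivative[OF bounded_linear_divide] has_derivative_diff has_derivative_mult has_derivative_mult_left has_derivative_add has_derivative_const)
    then have "((\<lambda>y. simanca_form y v w) has_derivative
      (\<lambda>u. ((1 / r\<^sup>2 * g' u v w + - (4 * (u \<bullet> z) / r ^ 3) * g v w) - (0 + - (2 * (u \<bullet> z) / r\<^sup>2)) * Im (herm v w)) / pi)) (at z)"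
      by (rule has_derivative_transform_within_open[where s = "- {0}"])
        (use z in \<open>auto simp: simanca_form_eq diff_divide_distrib\<close>)
    from frechet_derivative_at[OF this, symmetric] show ?thesis by simp
  qed
  have g: "(u \<bullet> z) * g v w + (v \<bullet> z) * g w u + (w \<bullet> z) * g u v = 0"
    by (simp add: g_def Re_herm[symmetric] algebra_simps)
  have "2 * (u \<bullet> z) * Im (herm v w) + 2 * (v \<bullet> z) * Im (herm w u) + 2 * (w \<bullet> z) * Im (herm u v)
     + g' u v w + g' v w u + g' w u v = 0"
    using herm_cnj[of u v, symmetric] herm_cnj[of v w, symmetric] herm_cnj[of w u, symmetric]
    by (simp add: g'_def Re_herm[symmetric] algebra_simps)
  then have "(2 * (u \<bullet> z) * Im (herm v w) + 2 * (v \<bullet> z) * Im (herm w u) + 2 * (w \<bullet> z) * Im (herm u v)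
     + g' u v w + g' v w u + g' w u v) / r\<^sup>2 
     - 4 / r ^ 3 * ((u \<bullet> z) * g v w + (v \<bullet> z) * g w u + (w \<bullet> z) * g u v) = 0"
    unfolding g by simp
  then show ?thesis
    unfolding D by (simp add: add_divide_distrib[symmetric]) (simp add: algebra_simps add_divide_distrib diff_divide_distrib)
qed

text \<open>Positivity of the Kaehler metric, which gives nondegeneracy. The negative term, with
  \<open>\<Phi>'' = - 1/r\<^sup>2\<close>, is absorbed by the part \<open>1/r\<close> of \<open>\<Phi>'\<close> through the Cauchy-Schwarz inequality, here in
  the form of Lagrange's identity.\<close>

lemma simanca_form_i:
  assumes z: "z \<noteq> 0"
  shows "simanca_form z u (\<chi> j. \<i> * u $ j) \<ge> (norm u)\<^sup>2 / pi"
proof -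
  define r where "r = z \<bullet> z"
  have r: "r > 0" using z by (simp add: r_def)
  have i: "herm u (\<chi> j. \<i> * u $ j) = - \<i> * herm u u" "herm (\<chi> j. \<i> * u $ j) z = \<i> * herm u z"
    by (simp_all add: herm_def sum_distrib_left mult_ac sum_negf)
  have uu: "Re (herm u u) = (norm u)\<^sup>2" by (simp add: Re_herm power2_norm_eq_inner)
  have "(cmod (herm u z))\<^sup>2 + (cmod (u $ 1 * z $ 2 - u $ 2 * z $ 1))\<^sup>2 = (norm u)\<^sup>2 * r"
    unfolding r_def uu[symmetric] Re_herm[symmetric]
    by (simp add: herm_def sum_2 cmod_power2) (simp add: power2_eq_square algebra_simps)
  then have "(cmod (herm u z))\<^sup>2 \<le> (norm u)\<^sup>2 * r"
    by (metis le_add_same_cancel1 zero_le_power2)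
  then have "(cmod (herm u z))\<^sup>2 / r\<^sup>2 \<le> (norm u)\<^sup>2 / r"
    using r by (simp add: field_simps power2_eq_square)
  moreover have "simanca_form z u (\<chi> j. \<i> * u $ j)
      = ((1 + 1 / r) * (norm u)\<^sup>2 - (cmod (herm u z))\<^sup>2 / r\<^sup>2) / pi"
    unfolding simanca_form_eq[OF z] i r_def[symmetric] uu[symmetric] cmod_power2
    by (simp add: power2_eq_square algebra_simps diff_divide_distrib add_divide_distrib)
  ultimately show ?thesis by (simp add: field_simps)
qed

lemma symplectic_domain_simanca: "symplectic_domain (UNIV - {0}) simanca_form"
proof
  note nz = DiffD2[of _ UNIV "{0 :: complex ^ 2}", unfolded singleton_iff]
  show "open (UNIV - {0 :: complex ^ 2})" by (rule open_punctured)
  fix x :: "complex ^ 2" assume x: "x \<in> UNIV - {0}"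
  let ?D = "frechet_derivative simanca_chart (at x)"
  have "linear ?D"
    using smooth_on_has_derivative[OF open_punctured smooth_on_simanca_chart x] has_derivative_linear by blast
  moreover have "simanca_form x = (\<lambda>u v. flat_form (?D u) (?D v))"
    using x by (intro ext simanca_form_pullback) simp
  ultimately show "bilinear (simanca_form x)"
    using bilinear_flat_form[where 'n = 2]
    by (auto simp: bilinear_def intro!: linear_compose[unfolded o_def, of ?D])
  show "simanca_form x u u = 0" for u
    using x by (simp add: simanca_form_eq Im_herm_self mult.commute)
  show "u = 0" if "\<And>v. simanca_form x u v = 0" for u
    using simanca_form_i[of x u] x that by (simp add: divide_le_0_iff linorder_not_le[THEN iffD2, OF pi_gt_zero])
  show "frechet_derivative (\<lambda>y. simanca_form y v w) (at x) u
    + frechet_derivative (\<lambda>y. simanca_form y w u) (at x) v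
    + frechet_derivative (\<lambda>y. simanca_form y u v) (at x) w = 0" for u v w
    by (rule simanca_closed) (use x in auto)
next
  fix u v :: "complex ^ 2"
  have "smooth_on (UNIV - {0}) (\<lambda>x. flat_form (frechet_derivative simanca_chart (at x) u) (frechet_derivative simanca_chart (at x) v))"
    using bilinear_flat_form
    by (intro smooth_on_bounded_bilinear[of flat_form] open_punctured smooth_on_frechet_derivative smooth_on_simanca_chart)
      (simp add: bilinear_conv_bounded_bilinear)
  then show "smooth_on (UNIV - {0}) (\<lambda>x. simanca_form x u v)"
    by (rule smooth_on_cong[OF open_punctured]) (simp add: simanca_form_pullback)
qed

section \<open>The quantization\<close>

theorem corollary1p3:
  shows "admits_berezin_quantization (UNIV - {0 :: complex ^ 2}) simanca_form"
proof -
  interpret constant_symplectic_chart "UNIV - {0 :: complex ^ 2}" simanca_form simanca_chart flat_form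
  proof (intro constant_symplectic_chart.intro constant_symplectic_chart_axioms.intro)
    have "axis 1 1 \<noteq> (0 :: complex ^ 2)" by (simp add: axis_eq_0_iff)
    then show "UNIV - {0 :: complex ^ 2} \<noteq> {}" by blast
  qed (auto intro: symplectic_domain_simanca smooth_on_simanca_chart inj_on_simanca_chart
      bilinear_flat_form simanca_form_pullback)
  show ?thesis
    unfolding admits_berezin_quantization_def using berezin_quantization_chart by blast
qed

end
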